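(* Let $(W,S)$ be a Coxeter system of finite rank and let $V$ be a complex representation of $W$ (of finite or infinite dimension). Then the elements $C_w\in\mathbb{C}[W]$ (Kazhdan–Lusztig basis elements specialized at $q^{1/2}=1$) act on $V$ by zero for all $w\in W$ with $\boldsymbol{a}(w)>1$ if and only if $V$ satisfies the following condition: there is no $v\in V\setminus\{0\}$ such that $r\cdot v=t\cdot v=-v$ for some $r\neq t\in S$ with $m_{rt}<\infty$.
   Context: $W=\langle S\mid s^2=(st)^{m_{st}}=e,\ \forall s\ne t\in S\rangle$ with $S$ finite, where $m_{st}=m_{ts}\in\{2,3,\dots\}\cup\{\infty\}$ is the order of $st$; $\ell$ is the length function and $\le$ the Bruhat order. Hecke algebra: $\mathcal H$ is the free $\mathbb{C}[q^{\pm 1/2}]$-module with basis $\{\widetilde T_w\}_{w\in W}$, with associative multiplication determined by $\widetilde T_s\widetilde T_w=\widetilde T_{sw}$ if $sw>w$ and $\widetilde T_s\widetilde T_w=(q^{1/2}-q^{-1/2})\widetilde T_w+\widetilde T_{sw}$ if $sw<w$ ($s\in S$, $w\in W$). The bar involution of $\mathcal H$ is the $\mathbb{C}$-algebra involution with $q^{1/2}\mapsto q^{-1/2}$, $\widetilde T_w\mapsto \widetilde T_{w^{-1}}^{-1}$. Kazhdan–Lusztig basis: $\{C_w\}_{w\in W}$ is the unique basis of $\mathcal H$ of the form $C_w=\sum_{y\in W}(-1)^{\ell(w)+\ell(y)}q^{\frac12(\ell(w)-\ell(y))}\,\overline{P_{y,w}}\,\widetilde T_y$ such that, for all $y,w\in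 W$: $\overline{C_w}=C_w$, $P_{y,w}\in\mathbb{Z}[q]$, $P_{y,w}=0$ unless $y\le w$, $P_{w,w}=1$, and $\deg_q P_{y,w}\le\frac12(\ell(w)-\ell(y)-1)$ if $y<w$. $\boldsymbol a$-function: write $C_xC_y=\sum_w h_{x,y,w}C_w$ with $h_{x,y,w}\in\mathbb{C}[q^{\pm1/2}]$; then $\boldsymbol a(w):=\min\{i\in\mathbb{N}\mid q^{i/2}h_{x,y,w}\in\mathbb{Z}[q^{1/2}]\ \forall x,y\in W\}$, which is a well-defined natural number. Specialization: setting $q^{1/2}=1$ turns $\mathcal H$ into the group algebra $\mathbb{C}[W]$ (with $\widetilde T_w\mapsto w$); the image of $C_w$ in $\mathbb{C}[W]$ is again denoted $C_w$. *)

theory Defs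
  imports
    Complex_Main
    "HOL-Library.Extended_Nat"
    "HOL-Library.Poly_Mapping"
    "HOL-Computational_Algebra.Polynomial"
begin

text \<open>
  The class \<^class>\<open>group_add\<close> consists of all groups, commutative or not, in additive notation.
  The Coxeter group \<open>W\<close> is the whole of a type of this class: the product \<open>x y\<close> is written
  \<open>x + y\<close>, the neutral element \<open>0\<close>, the inverse \<open>- x\<close>, and the product of a word is its
  \<^const>\<open>sum_list\<close>.
\<close>

section \<open>Group presentations\<close>

text \<open>A word in generators and their inverses; \<open>(s, False)\<close> stands for the inverse of \<open>s\<close>.\<close>

type_synonym 'w gword = "('w \<times> bool) list"

definition gword_value :: "'w::group_add gword \<Rightarrow> 'w" where
  "gword_value u = sum_list (map (\<lambda>(s, b). if b then s else - s) u)"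

text \<open>Equality of words in the group \<open>\<langle>S | R\<rangle>\<close>.\<close>

inductive pres_eq :: "'w set \<Rightarrow> 'w gword set \<Rightarrow> 'w gword \<Rightarrow> 'w gword \<Rightarrow> bool"
  for S R where
  refl: "u \<in> lists (S \<times> UNIV) \<Longrightarrow> pres_eq S R u u"
| sym: "pres_eq S R u v \<Longrightarrow> pres_eq S R v u"
| trans: "pres_eq S R u v \<Longrightarrow> pres_eq S R v w \<Longrightarrow> pres_eq S R u w"
| cancel: "u \<in> lists (S \<times> UNIV) \<Longrightarrow> v \<in> lists (S \<times> UNIV) \<Longrightarrow> s \<in> S \<Longrightarrow>
    pres_eq S R (u @ [(s, b), (s, \<not> b)] @ v) (u @ v)"
| relator: "u \<in> lists (S \<times> UNIV) \<Longrightarrow> v \<in> lists (S \<times> UNIV) \<Longrightarrow> r \<in> R \<Longrightarrow>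
    pres_eq S R (u @ r @ v) (u @ v)"

definition is_presentation :: "'w::group_add set \<Rightarrow> 'w gword set \<Rightarrow> bool" where
  "is_presentation S R \<longleftrightarrow>
     (\<forall>w. \<exists>u \<in> lists (S \<times> UNIV). gword_value u = w) \<and>
     (\<forall>u \<in> lists (S \<times> UNIV). \<forall>v \<in> lists (S \<times> UNIV).
        gword_value u = gword_value v \<longleftrightarrow> pres_eq S R u v)"

section \<open>Coxeter systems\<close>

text \<open>The infimum of the empty set in \<^typ>\<open>enat\<close> is \<open>\<infinity>\<close>.\<close>

definition element_order :: "'w::group_add \<Rightarrow> enat" where
  "element_order x = (INF n \<in> {n. 0 < n \<and> sum_list (replicate n x) = 0}. enat n)"

definition cox_m :: "'w::group_add \<Rightarrow> 'w \<Rightarrow> enat" where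
  "cox_m s t = element_order (s + t)"

definition coxeter_relators :: "'w::group_add set \<Rightarrow> 'w gword set" where
  "coxeter_relators S =
     {[(s, True), (s, True)] | s. s \<in> S} \<union>
     {concat (replicate n [(s, True), (t, True)]) | s t n.
        s \<in> S \<and> t \<in> S \<and> s \<noteq> t \<and> cox_m s t = enat n}"

text \<open>
  The labels are by definition the orders of the products \<open>s t\<close>. That they are at least \<open>2\<close> and
  that the generators are not trivial follows, because all relators have even length.
\<close>

definition coxeter_system :: "'w::group_add set \<Rightarrow> bool" where
  "coxeter_system S \<longleftrightarrow> is_presentation S (coxeter_relators S)"

definition cox_length :: "'w::group_add set \<Rightarrow> 'w \<Rightarrow> nat" where
  "cox_length S w = (LEAST n. \<exists>u \<in> lists S. length u = n \<and> sum_list u = w)"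

definition reflections :: "'w::group_add set \<Rightarrow> 'w set" where
  "reflections S = {w + s - w | w s. s \<in> S}"

definition bruhat_le :: "'w::group_add set \<Rightarrow> 'w \<Rightarrow> 'w \<Rightarrow> bool" where
  "bruhat_le S = (\<lambda>x y. cox_length S x < cox_length S y \<and> (\<exists>t \<in> reflections S. y = t + x))\<^sup>*\<^sup>*"

definition bruhat_less :: "'w::group_add set \<Rightarrow> 'w \<Rightarrow> 'w \<Rightarrow> bool" where
  "bruhat_less S x y \<longleftrightarrow> bruhat_le S x y \<and> x \<noteq> y"

section \<open>The Hecke algebra\<close>

text \<open>
  Laurent polynomials over \<open>\<complex>\<close> in the indeterminate \<open>q\<^sup>1\<^sup>/\<^sup>2\<close>: the monoid algebra of the
  additive monoid of the integers, where \<open>k\<close> is the exponent of \<open>q\<^sup>k\<^sup>/\<^sup>2\<close>.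
\<close>

type_synonym laurent = "int \<Rightarrow>\<^sub>0 complex"

definition qhalf :: "int \<Rightarrow> laurent" where
  "qhalf k = Poly_Mapping.single k 1"

definition laurent_bar :: "laurent \<Rightarrow> laurent" where
  "laurent_bar = Poly_Mapping.map_key uminus"

definition int_poly_at :: "int poly \<Rightarrow> laurent \<Rightarrow> laurent" where
  "int_poly_at p x = poly (map_poly of_int p) x"

text \<open>
  The free module with basis \<open>W\<close>. The multiplication that \<^typ>\<open>'w \<Rightarrow>\<^sub>0 laurent\<close> has in the
  library is the one of the group algebra of \<open>W\<close> and is not used.
\<close>

type_synonym 'w hecke = "'w \<Rightarrow>\<^sub>0 laurent"

definition hecke_scale :: "laurent \<Rightarrow> 'w hecke \<Rightarrow> 'w hecke" where
  "hecke_scale c h = Poly_Mapping.map (\<lambda>x. c * x) h"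

lemma lookup_hecke_scale:
  "Poly_Mapping.lookup (hecke_scale c h) w = c * Poly_Mapping.lookup h w"
  by (simp add: hecke_scale_def Poly_Mapping.map.rep_eq when_def)

interpretation hecke: module hecke_scale
  by unfold_locales
    (auto intro!: poly_mapping_eqI simp: lookup_hecke_scale lookup_add algebra_simps)

definition hecke_T :: "'w \<Rightarrow> 'w hecke" where
  "hecke_T w = Poly_Mapping.single w 1"

definition is_hecke_mult ::
    "'w::group_add set \<Rightarrow> ('w hecke \<Rightarrow> 'w hecke \<Rightarrow> 'w hecke) \<Rightarrow> bool" where
  "is_hecke_mult S mul \<longleftrightarrow>
     (\<forall>x. module_hom hecke_scale hecke_scale (\<lambda>y. mul x y)) \<and>
     (\<forall>y. module_hom hecke_scale hecke_scale (\<lambda>x. mul x y)) \<and>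
     (\<forall>x y z. mul (mul x y) z = mul x (mul y z)) \<and>
     (\<forall>x. mul (hecke_T 0) x = x \<and> mul x (hecke_T 0) = x) \<and>
     (\<forall>s \<in> S. \<forall>w. bruhat_less S w (s + w) \<longrightarrow>
        mul (hecke_T s) (hecke_T w) = hecke_T (s + w)) \<and>
     (\<forall>s \<in> S. \<forall>w. bruhat_less S (s + w) w \<longrightarrow>
        mul (hecke_T s) (hecke_T w) =
          hecke_scale (qhalf 1 - qhalf (-1)) (hecke_T w) + hecke_T (s + w))"

definition hecke_mult :: "'w::group_add set \<Rightarrow> 'w hecke \<Rightarrow> 'w hecke \<Rightarrow> 'w hecke" where
  "hecke_mult S = (THE mul. is_hecke_mult S mul)"

definition is_hecke_bar :: "'w::group_add set \<Rightarrow> ('w hecke \<Rightarrow> 'w hecke) \<Rightarrow> bool" where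
  "is_hecke_bar S b \<longleftrightarrow>
     (\<forall>x y. b (x + y) = b x + b y) \<and>
     (\<forall>c x. b (hecke_scale c x) = hecke_scale (laurent_bar c) (b x)) \<and>
     (\<forall>x y. b (hecke_mult S x y) = hecke_mult S (b x) (b y)) \<and>
     (\<forall>x. b (b x) = x) \<and>
     (\<forall>w. hecke_mult S (b (hecke_T w)) (hecke_T (- w)) = hecke_T 0 \<and>
          hecke_mult S (hecke_T (- w)) (b (hecke_T w)) = hecke_T 0)"

definition hecke_bar :: "'w::group_add set \<Rightarrow> 'w hecke \<Rightarrow> 'w hecke" where
  "hecke_bar S = (THE b. is_hecke_bar S b)"

section \<open>The Kazhdan--Lusztig basis and the a-function\<close>

definition is_kl_basis :: "'w::group_add set \<Rightarrow> ('w \<Rightarrow> 'w hecke) \<Rightarrow> bool" where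
  "is_kl_basis S C \<longleftrightarrow>
     inj C \<and> hecke.independent (range C) \<and> hecke.span (range C) = UNIV \<and>
     (\<exists>P :: 'w \<Rightarrow> 'w \<Rightarrow> int poly.
        (\<forall>y w. Poly_Mapping.lookup (C w) y =
           (- 1) ^ (cox_length S w + cox_length S y) *
           qhalf (int (cox_length S w) - int (cox_length S y)) *
           laurent_bar (int_poly_at (P y w) (qhalf 2))) \<and>
        (\<forall>w. hecke_bar S (C w) = C w) \<and>
        (\<forall>y w. \<not> bruhat_le S y w \<longrightarrow> P y w = 0) \<and>
        (\<forall>w. P w w = 1) \<and>
        (\<forall>y w. bruhat_less S y w \<longrightarrow>
           real (degree (P y w)) \<le> (real (cox_length S w) - real (cox_length S y) - 1) / 2))"

definition kl_C :: "'w::group_add set \<Rightarrow> 'w \<Rightarrow> 'w hecke" where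
  "kl_C S = (THE C. is_kl_basis S C)"

definition kl_h :: "'w::group_add set \<Rightarrow> 'w \<Rightarrow> 'w \<Rightarrow> 'w \<Rightarrow> laurent" where
  "kl_h S x y w =
     hecke.representation (range (kl_C S)) (hecke_mult S (kl_C S x) (kl_C S y)) (kl_C S w)"

text \<open>
  The minimum is taken as an infimum in \<^typ>\<open>enat\<close>; it is the minimum whenever the set is
  nonempty.
\<close>

definition a_fun :: "'w::group_add set \<Rightarrow> 'w \<Rightarrow> enat" where
  "a_fun S w =
     (INF i \<in> {i. \<forall>x y. qhalf (int i) * kl_h S x y w \<in> range (\<lambda>p. int_poly_at p (qhalf 1))}.
        enat i)"

section \<open>Specialization and representations\<close>

definition laurent_at_one :: "laurent \<Rightarrow> complex" where
  "laurent_at_one p = (\<Sum>k \<in> Poly_Mapping.keys p. Poly_Mapping.lookup p k)"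

text \<open>The group algebra \<open>\<complex>[W]\<close> is \<^typ>\<open>'w \<Rightarrow>\<^sub>0 complex\<close> with the multiplication of the library.\<close>

definition hecke_at_one :: "'w::group_add hecke \<Rightarrow> ('w \<Rightarrow>\<^sub>0 complex)" where
  "hecke_at_one h = Poly_Mapping.map laurent_at_one h"

definition complex_representation ::
    "(complex \<Rightarrow> 'v \<Rightarrow> 'v) \<Rightarrow> ('w::group_add \<Rightarrow> 'v \<Rightarrow> 'v::ab_group_add) \<Rightarrow> bool" where
  "complex_representation scale \<rho> \<longleftrightarrow>
     vector_space scale \<and>
     (\<forall>g. Vector_Spaces.linear scale scale (\<rho> g)) \<and>
     \<rho> 0 = id \<and>
     (\<forall>g h. \<rho> (g + h) = \<rho> g \<circ> \<rho> h)"

definition group_algebra_action ::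
    "(complex \<Rightarrow> 'v \<Rightarrow> 'v) \<Rightarrow> ('w::group_add \<Rightarrow> 'v \<Rightarrow> 'v::ab_group_add) \<Rightarrow>
     ('w \<Rightarrow>\<^sub>0 complex) \<Rightarrow> 'v \<Rightarrow> 'v" where
  "group_algebra_action scale \<rho> a v =
     (\<Sum>g \<in> Poly_Mapping.keys a. scale (Poly_Mapping.lookup a g) (\<rho> g v))"

end

theory Submission
  imports Defs
begin

text \<open>
  Call \<open>w\<close> branching if it has several reduced words. If \<open>w\<close> has two left descents \<open>r, t\<close>, then
  \<open>r\<close> and \<open>t\<close> act by \<open>-1\<close> on the image of \<open>C\<^sub>w\<close>, and \<open>m\<^sub>r\<^sub>t < \<infinity>\<close> because the support of \<open>C\<^sub>w\<close> is
  finite and stable under \<open>r\<close> and \<open>t\<close>; so \<open>C\<^sub>w\<close> acts by zero if no vector is negated by such a pair.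
  A branching \<open>w\<close> with a single left descent \<open>s\<close> is \<open>s w'\<close> with \<open>w'\<close> branching, and
  \<open>C\<^sub>s C\<^sub>w\<^sub>' = C\<^sub>w + \<Sum> \<mu>(z, w') C\<^sub>z\<close> involves only branching \<open>z\<close>, so that \<open>C\<^sub>w\<close> acts by zero by induction.
  The same formula shows that the \<open>C\<^sub>w\<close> with \<open>w\<close> branching span a two-sided ideal, modulo which the
  structure constants lie in \<open>\<int>\<close> or \<open>(q\<^sup>1\<^sup>/\<^sup>2 + q\<^sup>-\<^sup>1\<^sup>/\<^sup>2) \<int>\<close>; hence \<open>a(w) > 1\<close> forces \<open>w\<close> to be branching.
  Conversely, let \<open>w\<close> be the longest element of a finite dihedral \<open>\<langle>r, t\<rangle>\<close>. Then \<open>a(w) \<ge> 2\<close>, because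
  \<open>C\<^sub>w C\<^sub>w\<close> is a multiple of \<open>C\<^sub>w\<close> by a Laurent polynomial of lowest degree \<open>-\<ell>(w)/2\<close>, and \<open>C\<^sub>w\<close>
  multiplies a vector negated by \<open>r\<close> and \<open>t\<close> by \<open>\<plusminus>|\<langle>r, t\<rangle>|\<close>.
\<close>

section \<open>Coxeter groups\<close>

text \<open>Multiplication, bar involution and basis are given by \<open>THE\<close>, so each is
  constructed and shown unique before anything is computed with it. The exchange condition, on which
  the constructions rest, is extracted from the presentation by letting \<open>W\<close> act on
  signed reflections.

  Why no other \<open>z\<close> can occur in \<open>C\<^sub>s C\<^sub>w\<^sub>'\<close>: if
  \<open>r\<close> is a left descent of \<open>w'\<close> but not of \<open>z\<close>, and
  \<open>\<mu>(z, w') \<noteq> 0\<close>, then \<open>w' = r z\<close>. For a non-branching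
  \<open>z\<close> with left descent \<open>s\<close> this would hold for every left descent
  \<open>r\<close> of \<open>w'\<close>. So \<open>w'\<close> would have exactly one left descent
  \<open>r\<close>, and removing the only first letter of a branching element leaves a branching
  one, namely \<open>z = r w'\<close>.

  Modulo the ideal only elements with a single reduced word remain. Two such factors interact where
  the last letter of the first meets the first letter of the second, and this happens with equal
  letters at most once; hence at most one factor \<open>q^(1/2) + q^(-1/2)\<close>.

  At \<open>q^(1/2) = 1\<close> the element \<open>C\<^sub>s\<close> becomes \<open>s - 1\<close>,
  and \<open>C\<^sub>s C\<^sub>w = - (q^(1/2) + q^(-1/2)) C\<^sub>w\<close> becomes the statement
  that the left descent \<open>s\<close> negates the image of \<open>C\<^sub>w\<close>.\<close>

definition npow :: "nat \<Rightarrow> 'a::monoid_add \<Rightarrow> 'a" where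
  "npow n x = sum_list (replicate n x)"

lemma npow_simps [simp]: "npow 0 x = 0" "npow (Suc n) x = x + npow n x"
  by (simp_all add: npow_def)

lemma npow_add: "npow (m + n) x = npow m x + npow n x"
  by (induction m) (simp_all add: add.assoc)

lemma npow_Suc_right: "npow (Suc n) x = npow n x + x"
  using npow_add[of n 1 x] by simp

lemma npow_minus: "npow n (- x) = - npow n (x::'a::group_add)"
proof (induction n)
  case (Suc n)
  then show ?case by (subst npow_Suc_right) (simp add: minus_add)
qed simp

lemma funpow_plus: "((+) d ^^ n) x = npow n d + x"
  by (induction n) (simp_all add: add.assoc)

lemma cox_m_finite_iff: "cox_m s t < \<infinity> \<longleftrightarrow> (\<exists>n>0. npow n (s + t) = 0)"
proof -
  let ?A = "{n. 0 < n \<and> sum_list (replicate n (s + t)) = 0}"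
  have "cox_m s t < \<infinity> \<longleftrightarrow> (\<exists>n\<in>?A. enat n < \<infinity>)"
    unfolding cox_m_def element_order_def by (rule INF_less_iff)
  then show ?thesis by (auto simp: npow_def)
qed

lemma cox_m_eq_enat: "npow n (s + t) = 0" if "cox_m s t = enat n"
proof -
  let ?A = "{n. 0 < n \<and> sum_list (replicate n (s + t)) = 0}"
  have "?A \<noteq> {}"
    using that unfolding cox_m_def element_order_def by (auto simp: Inf_enat_def split: if_splits)
  then obtain m where "m \<in> ?A" by blast
  then have "Inf (enat ` ?A) \<in> enat ` ?A"
    by (intro wellorder_InfI[of "enat m"] imageI)
  with that show ?thesis
    unfolding cox_m_def element_order_def by (auto simp: npow_def)
qed

lemmas group_normalize = diff_conv_add_uminus minus_add add.assoc

locale coxeter =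
  fixes S :: "'w::group_add set"
  assumes coxeter_system: "coxeter_system S"
begin

abbreviation R :: "'w gword set" where
  "R \<equiv> coxeter_relators S"

text \<open>The flag of a letter is ignored: generators are mapped to involutions, so a generator
  and its formal inverse act alike.\<close>

definition word_map :: "('w \<Rightarrow> 'a \<Rightarrow> 'a) \<Rightarrow> 'w gword \<Rightarrow> 'a \<Rightarrow> 'a" where
  "word_map f u = foldr (\<lambda>(s, b) g. f s \<circ> g) u id"

lemma word_map_append: "word_map f (u @ v) = word_map f u \<circ> word_map f v"
  by (induction u) (auto simp: word_map_def fun_eq_iff)

lemma gword_value_append: "gword_value (u @ v) = gword_value u + gword_value v"
  by (simp add: gword_value_def)

lemma pres_eq_value:
  "u \<in> lists (S \<times> UNIV) \<Longrightarrow> v \<in> lists (S \<times> UNIV) \<Longrightarrow>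
    gword_value u = gword_value v \<longleftrightarrow> pres_eq S R u v"
  using coxeter_system unfolding coxeter_system_def is_presentation_def by blast

lemma exists_gword: "\<exists>u. u \<in> lists (S \<times> UNIV) \<and> gword_value u = w"
  using coxeter_system unfolding coxeter_system_def is_presentation_def by blast

text \<open>The universal property of the presentation, for actions on an arbitrary type. Evaluation
  of words is invariant under every rule of \<open>pres_eq\<close>, so it does not matter which word
  is chosen for a group element.\<close>

lemma extend_hom:
  fixes f :: "'w \<Rightarrow> 'a \<Rightarrow> 'a"
  assumes inv: "\<And>s. s \<in> S \<Longrightarrow> f s \<circ> f s = id"
    and rel: "\<And>s t n. s \<in> S \<Longrightarrow> t \<in> S \<Longrightarrow> s \<noteq> t \<Longrightarrow> cox_m s t = enat n \<Longrightarrow>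
      (f s \<circ> f t) ^^ n = id"
  obtains \<phi> where "\<phi> 0 = id" "\<And>s. s \<in> S \<Longrightarrow> \<phi> s = f s" "\<And>x y. \<phi> (x + y) = \<phi> x \<circ> \<phi> y"
proof -
  have *: "word_map f r = id" if "r \<in> R" for r
  proof -
    have "word_map f (concat (replicate n [(s, True), (t, True)])) = (f s \<circ> f t) ^^ n" for s t n
      by (induction n) (auto simp: word_map_def)
    with that rel inv show ?thesis
      by (auto simp: coxeter_relators_def) (simp add: word_map_def)
  qed
  have eq: "word_map f u = word_map f v" if "pres_eq S R u v" for u v
    using that
  proof induction
    case (cancel u v s b)
    have "word_map f [(s, b), (s, \<not> b)] = id"
      using inv[OF cancel(3)] by (simp add: word_map_def)
    then show ?case unfolding word_map_append by simp
  next
    case (relator u v r)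
    then show ?case using * by (simp add: word_map_append)
  qed auto
  define \<phi> where "\<phi> w = word_map f (SOME u. u \<in> lists (S \<times> UNIV) \<and> gword_value u = w)" for w
  have \<phi>: "\<phi> (gword_value u) = word_map f u" if "u \<in> lists (S \<times> UNIV)" for u
  proof -
    let ?u = "SOME u'. u' \<in> lists (S \<times> UNIV) \<and> gword_value u' = gword_value u"
    have "?u \<in> lists (S \<times> UNIV) \<and> gword_value ?u = gword_value u"
      by (rule someI_ex[OF exists_gword])
    then show ?thesis unfolding \<phi>_def
      using eq pres_eq_value that by blast
  qed
  show ?thesis
  proof
    show "\<phi> 0 = id" using \<phi>[of "[]"] by (simp add: word_map_def gword_value_def)
    show "\<phi> s = f s" if "s \<in> S" for s
      using \<phi>[of "[(s, True)]"] that by (simp add: word_map_def gword_value_def)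
    show "\<phi> (x + y) = \<phi> x \<circ> \<phi> y" for x y
    proof -
      obtain u v where u: "u \<in> lists (S \<times> UNIV)" "gword_value u = x"
        and v: "v \<in> lists (S \<times> UNIV)" "gword_value v = y"
        using exists_gword by metis
      then show ?thesis
        using \<phi>[of u] \<phi>[of v] \<phi>[of "u @ v"] by (simp add: word_map_append gword_value_append)
    qed
  qed
qed

lemma gen_double [simp]: "s \<in> S \<Longrightarrow> s + s = 0"
proof -
  assume s: "s \<in> S"
  have "pres_eq S R ([] @ [(s, True), (s, True)] @ []) ([] @ [])"
    by (rule pres_eq.relator) (use s in \<open>auto simp: coxeter_relators_def\<close>)
  then have "gword_value [(s, True), (s, True)] = gword_value []"
    using pres_eq_value[of "[(s, True), (s, True)]" "[]"] s by auto
  then show ?thesis by (simp add: gword_value_def)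
qed

lemma gen_minus [simp]: "s \<in> S \<Longrightarrow> - s = s"
  by (rule minus_unique) simp

lemma gen_add_cancel [simp]: "s \<in> S \<Longrightarrow> s + (s + w) = w" "s \<in> S \<Longrightarrow> w + s + s = w"
  by (simp_all flip: add.assoc) (simp add: add.assoc)

lemma exists_word: "\<exists>u \<in> lists S. sum_list u = w"
proof -
  obtain u where "u \<in> lists (S \<times> UNIV)" "gword_value u = w"
    using exists_gword by metis
  moreover have "u \<in> lists (S \<times> UNIV) \<Longrightarrow> gword_value u = sum_list (map fst u)"
    by (induction u) (auto simp: gword_value_def)
  moreover have "u \<in> lists (S \<times> UNIV) \<Longrightarrow> map fst u \<in> lists S"
    by (induction u) auto
  ultimately show ?thesis by (metis (no_types))
qed

lemma word_induct [case_names zero gen]: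
  assumes "P 0" "\<And>s w. s \<in> S \<Longrightarrow> P w \<Longrightarrow> P (s + w)"
  shows "P w"
proof -
  obtain u where "u \<in> lists S" "sum_list u = w" using exists_word by blast
  moreover have "u \<in> lists S \<Longrightarrow> P (sum_list u)"
    by (induction u) (auto intro: assms)
  ultimately show ?thesis by blast
qed

section \<open>Inversions and the exchange condition\<close>

lemma dihedral_conj:
  assumes "s \<in> S" "t \<in> S"
  shows "- npow k (s + t) + ((+) (t + s) ^^ j) t + npow k (s + t) = ((+) (t + s) ^^ (2 * k + j)) t"
proof (induction k arbitrary: j)
  case (Suc k)
  have move: "((+) d ^^ j) a + b = ((+) d ^^ j) (a + b)" for a b d :: 'w and j
    by (induction j) (simp_all add: add.assoc)
  have "- npow (Suc k) (s + t) + ((+) (t + s) ^^ j) t + npow (Suc k) (s + t) =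
      - npow k (s + t) + (- (s + t) + (((+) (t + s) ^^ j) t + (s + t))) + npow k (s + t)"
    by (simp add: group_normalize del: add_uminus_conv_diff)
  also have "- (s + t) + (((+) (t + s) ^^ j) t + (s + t)) = ((+) (t + s) ^^ Suc (Suc j)) t"
    unfolding move using assms by (simp add: minus_add funpow_swap1 add.assoc)
  finally show ?case using Suc.IH[of "Suc (Suc j)"] by simp
qed simp

text \<open>Tits's action of \<open>W\<close> on pairs of a reflection and a sign, which yields the exchange condition.\<close>

definition refl_act :: "'w \<Rightarrow> 'w \<times> int \<Rightarrow> 'w \<times> int" where
  "refl_act s = (\<lambda>(x, e). (s + x + s, if x = s then - e else e))"

text \<open>The sign flips whenever the running conjugate of \<open>x\<close> meets \<open>t\<close>
  or \<open>s\<close>. By \<open>dihedral_conj\<close>, conjugation shifts the index of the dihedral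
  reflection \<open>(t s)^j t\<close> by two per factor \<open>s + t\<close>; pulled back to
  \<open>x\<close>, the meetings are therefore \<open>x = (t s)^j t\<close> for
  \<open>j < 2 * k\<close>.\<close>

lemma refl_act_pow:
  assumes s: "s \<in> S" and t: "t \<in> S"
  shows "((refl_act s \<circ> refl_act t) ^^ k) (x, e) =
    (npow k (s + t) + x - npow k (s + t),
      (\<Prod>j<2*k. if x = ((+) (t + s) ^^ j) t then - 1 else 1) * e)"
proof (induction k)
  case (Suc k)
  let ?y = "npow k (s + t) + x - npow k (s + t)"
  have conj: "?y = ((+) (t + s) ^^ j) t \<longleftrightarrow> x = ((+) (t + s) ^^ (2 * k + j)) t" for j
  proof -
    have "?y = a \<longleftrightarrow> x = - npow k (s + t) + a + npow k (s + t)" for a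
    proof
      show "x = - npow k (s + t) + a + npow k (s + t)" if "?y = a"
        by (simp flip: that add: group_normalize del: add_uminus_conv_diff)
      show "?y = a" if "x = - npow k (s + t) + a + npow k (s + t)"
        by (simp add: that group_normalize del: add_uminus_conv_diff)
    qed
    then show ?thesis by (simp only: dihedral_conj[OF s t])
  qed
  have "t + ?y + t = s \<longleftrightarrow> ?y = t + s + t"
  proof
    assume "t + ?y + t = s"
    then have "t + (t + ?y + t) + t = t + s + t" by simp
    then show "?y = t + s + t" using t by (simp add: add.assoc)
  next
    assume "?y = t + s + t"
    then show "t + ?y + t = s" using t by (simp add: add.assoc)
  qed
  then have "t + ?y + t = s \<longleftrightarrow> x = ((+) (t + s) ^^ (2 * k + 1)) t"
    using conj[of 1] by (simp add: add.assoc)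
  moreover have "?y = t \<longleftrightarrow> x = ((+) (t + s) ^^ (2 * k)) t" using conj[of 0] by simp
  moreover have "s + (t + ?y + t) + s = npow (Suc k) (s + t) + x - npow (Suc k) (s + t)"
    using s t by (simp add: group_normalize del: add_uminus_conv_diff)
  ultimately have "refl_act s (refl_act t (?y, e')) =
      (npow (Suc k) (s + t) + x - npow (Suc k) (s + t),
        (if x = ((+) (t + s) ^^ (2 * k)) t then - 1 else 1) *
        (if x = ((+) (t + s) ^^ (2 * k + 1)) t then - 1 else 1) * e')" for e'
    unfolding refl_act_def split_conv by (simp only: prod.inject) auto
  note step = this
  define g :: "nat \<Rightarrow> int" where "g = (\<lambda>j. if x = ((+) (t + s) ^^ j) t then - 1 else 1)"
  have "((refl_act s \<circ> refl_act t) ^^ Suc k) (x, e) = refl_act s (refl_act t (?y, prod g {..<2 * k} * e))"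
    by (simp only: funpow.simps o_apply Suc.IH g_def)
  also have "\<dots> = (npow (Suc k) (s + t) + x - npow (Suc k) (s + t),
      g (2 * k) * g (2 * k + 1) * (prod g {..<2 * k} * e))"
    unfolding step g_def ..
  also have "g (2 * k) * g (2 * k + 1) * (prod g {..<2 * k} * e) = prod g {..<2 * Suc k} * e"
    by simp
  finally show ?case unfolding g_def .
qed simp

text \<open>The sign in Tits's action records, modulo two, how often a reflection is met along a
  word of \<open>w\<close>. That the generators extend to an action of \<open>W\<close> makes this
  parity independent of the word.\<close>

lemma exists_reflection_cocycle:
  "\<exists>N. (\<forall>t. \<not> N 0 t) \<and> (\<forall>s\<in>S. \<forall>w t. N (s + w) t \<longleftrightarrow> (t = s) \<noteq> N w (s + t + s))"
proof -
  have inv: "refl_act s \<circ> refl_act s = id" if "s \<in> S" for s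
  proof -
    have "s + x + s = s \<longleftrightarrow> x = s" for x
    proof
      assume "s + x + s = s"
      then have "s + (s + x + s) + s = s + s + s" by simp
      then show "x = s" using that by (simp add: add.assoc)
    qed (use that in simp)
    then show ?thesis using that
      by (auto simp: refl_act_def fun_eq_iff add.assoc)
  qed
  have rel: "(refl_act s \<circ> refl_act t) ^^ n = id"
    if "s \<in> S" "t \<in> S" "s \<noteq> t" "cox_m s t = enat n" for s t n
  proof
    fix p :: "'w \<times> int"
    obtain x e where p: "p = (x, e)" by force
    have n: "npow n (s + t) = 0" using cox_m_eq_enat that by blast
    have "t + s = - (s + t)" using that by (simp add: minus_add)
    then have "npow n (t + s) = 0" by (simp add: npow_minus n)
    define g :: "nat \<Rightarrow> int" where "g j = (if x = ((+) (t + s) ^^ j) t then - 1 else 1)" for j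
    \<comment> \<open>The sign factors have period \<open>n\<close>, so each occurs twice among the
      \<open>2 * n\<close> factors and the signs cancel.\<close>
    have "g (n + j) = g j" for j
      using \<open>npow n (t + s) = 0\<close> by (simp add: g_def funpow_plus npow_add)
    moreover have "prod g {..<n + m} = prod g {..<n} * (\<Prod>j<m. g (n + j))" for m
      by (induction m) (simp_all add: mult.assoc)
    ultimately have "prod g {..<2 * n} = prod (\<lambda>j. g j * g j) {..<n}"
      by (simp add: mult_2 prod.distrib)
    also have "\<dots> = 1" by (rule prod.neutral) (auto simp: g_def)
    finally show "((refl_act s \<circ> refl_act t) ^^ n) p = id p"
      using refl_act_pow[OF that(1,2), of n x e] by (simp add: p n g_def)
  qed
  obtain \<phi> where \<phi>: "\<phi> 0 = id" "\<And>s. s \<in> S \<Longrightarrow> \<phi> s = refl_act s"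
      "\<And>x y. \<phi> (x + y) = \<phi> x \<circ> \<phi> y"
    using extend_hom[of refl_act] inv rel by metis
  \<comment> \<open>\<open>\<phi> w\<close> treats both signs alike, so the initial sign only
    multiplies the outcome.\<close>
  have sgn: "snd (\<phi> w (x, e)) = snd (\<phi> w (x, 1)) * e \<and> snd (\<phi> w (x, 1)) \<in> {-1, 1}" for w x e
  proof (induction w arbitrary: x e rule: word_induct)
    case zero
    then show ?case by (simp add: \<phi>)
  next
    case (gen s w)
    have "fst (\<phi> w (x, e)) = fst (\<phi> w (x, e'))" for w e e'
    proof (induction w arbitrary: x rule: word_induct)
      case (gen s w)
      then show ?case using \<phi>(3)[of s w] \<phi>(2)[of s] by (simp add: refl_act_def split_beta)
    qed (simp add: \<phi>)
    then have "fst (\<phi> w (x, e)) = fst (\<phi> w (x, 1))" by simp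
    moreover have "snd (\<phi> w (x, e)) = snd (\<phi> w (x, 1)) * e" "snd (\<phi> w (x, 1)) \<in> {-1, 1}"
      using gen(2)[of x e] by auto
    ultimately show ?case using \<phi>(3)[of s w] \<phi>(2)[of s] gen(1)
      by (auto simp: refl_act_def split_beta)
  qed
  \<comment> \<open>The inverse of \<open>w\<close> is taken so that a left factor \<open>s\<close>
    of \<open>w\<close> is the first to act.\<close>
  define N where "N w t = (snd (\<phi> (- w) (t, 1)) = - 1)" for w t
  have "\<not> N 0 t" for t by (simp add: N_def \<phi>)
  moreover have "N (s + w) t \<longleftrightarrow> (t = s) \<noteq> N w (s + t + s)" if "s \<in> S" for s w t
  proof -
    have "\<phi> (- (s + w)) (t, 1) = \<phi> (- w) (s + t + s, if t = s then - 1 else 1)"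
      using \<phi>(3)[of "- w" s] \<phi>(2)[OF that] that by (simp add: minus_add refl_act_def)
    then show ?thesis
      using sgn[of "- w" "s + t + s" "if t = s then - 1 else 1"] by (auto simp: N_def)
  qed
  ultimately show ?thesis by blast
qed

text \<open>For a reflection \<open>t\<close> this says that \<open>t\<close> is a left inversion of
  \<open>w\<close>, that is, \<open>len (t + w) < len w\<close>
  (\<open>len_refl_iff\<close>).\<close>

definition inv_set :: "'w \<Rightarrow> 'w \<Rightarrow> bool" where
  "inv_set = (SOME N. (\<forall>t. \<not> N 0 t) \<and>
     (\<forall>s\<in>S. \<forall>w t. N (s + w) t \<longleftrightarrow> (t = s) \<noteq> N w (s + t + s)))"

lemma inv_set_zero [simp]: "\<not> inv_set 0 t"
  and inv_set_gen: "s \<in> S \<Longrightarrow> inv_set (s + w) t \<longleftrightarrow> (t = s) \<noteq> inv_set w (s + t + s)"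
  using someI_ex[OF exists_reflection_cocycle] unfolding inv_set_def by blast+

text \<open>The rule for generators, iterated into the cocycle rule: a symmetric difference of
  inversion sets. It gives access to reflections and to right factors.\<close>

lemma inv_set_add: "inv_set (x + y) t \<longleftrightarrow> inv_set x t \<noteq> inv_set y (- x + t + x)"
proof (induction x arbitrary: t rule: word_induct)
  case (gen s x)
  have "- (s + x) + t + (s + x) = - x + (s + t + s) + x"
    using gen(1) by (simp add: group_normalize del: add_uminus_conv_diff)
  then show ?case
    using inv_set_gen[OF gen(1), of "x + y" t] inv_set_gen[OF gen(1), of x t] gen(2)[of "s + t + s"]
    by (simp only: add.assoc) blast
qed simp

lemma inv_set_gen_single: "s \<in> S \<Longrightarrow> inv_set s t \<longleftrightarrow> t = s"
  using inv_set_gen[of s 0 t] by simp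

lemma gen_reflection: "s \<in> S \<Longrightarrow> s \<in> reflections S"
  unfolding reflections_def by (rule CollectI, rule exI[of _ 0]) auto

lemma reflection_conj:
  assumes "t \<in> reflections S" shows "w + t - w \<in> reflections S"
proof -
  obtain x s where "s \<in> S" "t = x + s - x" using assms by (auto simp: reflections_def)
  then have "w + t - w = (w + x) + s - (w + x)"
    by (simp add: group_normalize del: add_uminus_conv_diff)
  then show ?thesis using \<open>s \<in> S\<close> by (auto simp: reflections_def)
qed

lemma reflection_double: "t \<in> reflections S \<Longrightarrow> t + t = 0"
  by (auto simp: reflections_def diff_conv_add_uminus add.assoc simp del: add_uminus_conv_diff)

text \<open>For \<open>t = x + s - x\<close> the contributions of \<open>x\<close> and of
  \<open>- x\<close> cancel, and the single flip at \<open>s\<close> remains.\<close>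

lemma inv_set_refl_self:
  assumes "t \<in> reflections S" shows "inv_set t t"
proof -
  obtain x s where s: "s \<in> S" and t: "t = x + s - x" using assms by (auto simp: reflections_def)
  have c: "- x + t + x = s"
    by (simp add: t group_normalize del: add_uminus_conv_diff)
  have "inv_set t t \<longleftrightarrow> inv_set x t \<noteq> inv_set (s + - x) s"
    using inv_set_add[of x "s + - x" t] c by (simp add: t group_normalize del: add_uminus_conv_diff)
  also have "inv_set (s + - x) s \<longleftrightarrow> \<not> inv_set (- x) s"
    using inv_set_gen[OF s, of "- x" s] s by (simp del: add_uminus_conv_diff)
  also have "inv_set (- x) s \<longleftrightarrow> inv_set x t"
    using inv_set_add[of x "- x" t] c by simp
  finally show ?thesis by blast
qed

lemma inv_set_refl_add:
  assumes "t \<in> reflections S" shows "inv_set (t + w) t \<longleftrightarrow> \<not> inv_set w t"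
  using inv_set_add[of t w t] inv_set_refl_self[OF assms] by simp

text \<open>The strong exchange condition. Moving \<open>t\<close> past the letters conjugates it
  until it equals the next letter, which is then deleted. That \<open>v\<close> uses only letters of
  \<open>u\<close> later keeps reduced words and Bruhat-smaller elements inside a dihedral
  subgroup.\<close>

lemma exchange:
  assumes "u \<in> lists S" "inv_set (sum_list u) t"
  shows "\<exists>v. set v \<subseteq> set u \<and> Suc (length v) = length u \<and> t + sum_list u = sum_list v"
  using assms
proof (induction u arbitrary: t)
  case (Cons a u)
  note a = \<open>a \<in> S\<close>
  show ?case
  proof (cases "t = a")
    case True
    then show ?thesis using a by (intro exI[of _ u]) auto
  next
    case False
    then have "inv_set (sum_list u) (a + t + a)" using Cons.prems inv_set_gen[OF a] by simp
    then obtain v where v: "set v \<subseteq> set u" "Suc (length v) = length u"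
        "a + t + a + sum_list u = sum_list v"
      using Cons.IH by blast
    have "t + (a + sum_list u) = a + (a + t + a + sum_list u)" using a by (simp add: add.assoc)
    with v show ?thesis by (intro exI[of _ "a # v"]) auto
  qed
qed simp

section \<open>The length function, descents and reduced words\<close>

abbreviation len :: "'w \<Rightarrow> nat" where "len \<equiv> cox_length S"

lemma len_le: "u \<in> lists S \<Longrightarrow> len (sum_list u) \<le> length u"
  unfolding cox_length_def by (rule Least_le) auto

definition red :: "'w list \<Rightarrow> bool" where
  "red u \<longleftrightarrow> u \<in> lists S \<and> len (sum_list u) = length u"

lemma exists_red: "\<exists>u. red u \<and> sum_list u = w"
proof -
  have "\<exists>n. \<exists>u \<in> lists S. length u = n \<and> sum_list u = w" using exists_word by blast
  from LeastI_ex[OF this] show ?thesis by (auto simp: cox_length_def red_def)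
qed

lemma len_zero [simp]: "len 0 = 0"
  using len_le[of "[]"] by simp

lemma len_eq_0_iff [simp]: "len w = 0 \<longleftrightarrow> w = 0"
  using exists_red[of w] by (auto simp: red_def)

lemma len_uminus [simp]: "len (- w) = len w"
proof -
  have "len (- w) \<le> len w" for w
  proof -
    obtain u where u: "red u" "sum_list u = w" using exists_red by blast
    have "u \<in> lists S \<Longrightarrow> - sum_list u = sum_list (rev u)" for u
      by (induction u) (auto simp: minus_add)
    then show ?thesis using u len_le[of "rev u"] by (auto simp: red_def in_lists_conv_set)
  qed
  from this[of w] this[of "- w"] show ?thesis by simp
qed

lemma inv_set_imp_len: "inv_set w t \<Longrightarrow> len (t + w) < len w"
proof -
  assume *: "inv_set w t"
  obtain u where u: "red u" "sum_list u = w" using exists_red by blast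
  then obtain v where "set v \<subseteq> set u" "Suc (length v) = length u" "t + w = sum_list v"
    using exchange[of u t] * by (auto simp: red_def)
  with u len_le[of v] show ?thesis by (force simp: red_def in_lists_conv_set)
qed

lemma len_refl_iff:
  assumes "t \<in> reflections S"
  shows "len (t + w) < len w \<longleftrightarrow> inv_set w t" and "len w < len (t + w) \<longleftrightarrow> \<not> inv_set w t"
proof -
  have "t + (t + w) = w" using reflection_double[OF assms] by (simp flip: add.assoc)
  then have "\<not> inv_set w t \<Longrightarrow> len w < len (t + w)"
    using inv_set_imp_len[of "t + w" t] inv_set_refl_add[OF assms] by simp
  then show "len (t + w) < len w \<longleftrightarrow> inv_set w t" "len w < len (t + w) \<longleftrightarrow> \<not> inv_set w t"
    using inv_set_imp_len[of w t] less_asym by blast+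
qed

abbreviation ldesc :: "'w \<Rightarrow> 'w \<Rightarrow> bool" where
  "ldesc s w \<equiv> len (s + w) < len w"

lemma ldesc_iff: "s \<in> S \<Longrightarrow> ldesc s w \<longleftrightarrow> inv_set w s"
  and not_ldesc_iff: "s \<in> S \<Longrightarrow> len w < len (s + w) \<longleftrightarrow> \<not> ldesc s w"
  using len_refl_iff[OF gen_reflection] by auto

lemma len_gen:
  assumes "s \<in> S" shows "len (s + w) = (if ldesc s w then len w - 1 else Suc (len w))"
proof -
  have le: "len (s + w) \<le> Suc (len w)" for w
  proof -
    obtain u where u: "red u" "sum_list u = w" using exists_red by blast
    then show ?thesis using len_le[of "s # u"] assms by (auto simp: red_def)
  qed
  show ?thesis using le[of w] le[of "s + w"] not_ldesc_iff[OF assms, of w] assms by auto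
qed

lemma ldesc_len: "s \<in> S \<Longrightarrow> ldesc s w \<Longrightarrow> Suc (len (s + w)) = len w"
  using len_gen[of s w] by auto

lemma not_ldesc_len: "s \<in> S \<Longrightarrow> \<not> ldesc s w \<Longrightarrow> len (s + w) = Suc (len w)"
  using len_gen[of s w] by auto

lemma ldesc_gen_self: "s \<in> S \<Longrightarrow> ldesc s (s + w) \<longleftrightarrow> \<not> ldesc s w"
  using not_ldesc_iff[of s w] by auto

lemma len_gen_single [simp]: "s \<in> S \<Longrightarrow> len s = 1"
  using len_gen[of s 0] by simp

lemma len_gen_right: "s \<in> S \<Longrightarrow> len (w + s) = len (s + - w)"
  using len_uminus[of "w + s"] by (simp add: minus_add del: len_uminus)

lemma not_rdesc_iff: "s \<in> S \<Longrightarrow> len w < len (w + s) \<longleftrightarrow> \<not> len (w + s) < len w"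
  using not_ldesc_iff[of s "- w"] by (simp add: len_gen_right)

lemma rdesc_gen_self: "s \<in> S \<Longrightarrow> len (w + s + s) < len (w + s) \<longleftrightarrow> \<not> len (w + s) < len w"
  using not_rdesc_iff[of s w] by auto

text \<open>By the cocycle rule, right multiplication by \<open>t\<close> changes the inversion
  status of a single element, \<open>w + t - w\<close>; so this must be \<open>s\<close>.\<close>

lemma gen_conj_eq:
  assumes "s \<in> S" "t \<in> S" "ldesc s (w + t) \<noteq> ldesc s w"
  shows "s + w = w + t"
proof -
  have "inv_set t (- w + s + w)"
    using assms inv_set_add[of w t s] by (auto simp only: ldesc_iff)
  then have "- w + s + w = t" using assms by (simp add: inv_set_gen_single)
  then have "w + (- w + s + w) = w + t" by simp
  then show ?thesis by (simp add: add.assoc)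
qed

lemma exists_ldesc: assumes "w \<noteq> 0" shows "\<exists>s \<in> S. ldesc s w"
proof -
  obtain u where u: "red u" "sum_list u = w" using exists_red by blast
  with assms obtain a v where [simp]: "u = a # v" by (cases u) auto
  have "a \<in> S" "v \<in> lists S" using u by (auto simp: red_def)
  moreover have "a + w = sum_list v" using u \<open>a \<in> S\<close> by auto
  ultimately show ?thesis using len_le[of v] u by (auto simp: red_def intro!: bexI[of _ a])
qed

lemma len_induct [case_names zero gen]:
  assumes "P 0" "\<And>s w. s \<in> S \<Longrightarrow> \<not> ldesc s w \<Longrightarrow> P w \<Longrightarrow> P (s + w)"
  shows "P w"
proof (induction "len w" arbitrary: w rule: less_induct)
  case less
  show ?case
  proof (cases "w = 0")
    case False
    then obtain s where s: "s \<in> S" "ldesc s w" using exists_ldesc by blast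
    then have "P (s + w)" using less by blast
    then show ?thesis using assms(2)[of s "s + w"] s ldesc_gen_self[of s "s + w"] by simp
  qed (use assms in simp)
qed

lemma red_Cons: "s \<in> S \<Longrightarrow> red u \<Longrightarrow> \<not> ldesc s (sum_list u) \<Longrightarrow> red (s # u)"
  using not_ldesc_len[of s "sum_list u"] by (auto simp: red_def)

lemma red_ConsD:
  assumes "red (s # u)"
  shows "s \<in> S" "red u" "\<not> ldesc s (sum_list u)" "ldesc s (sum_list (s # u))"
proof -
  show s: "s \<in> S" using assms by (auto simp: red_def)
  have u: "u \<in> lists S" using assms by (auto simp: red_def)
  have "len (s + sum_list u) = Suc (length u)" using assms by (auto simp: red_def)
  then show "red u" "\<not> ldesc s (sum_list u)" "ldesc s (sum_list (s # u))"
    using len_le[OF u] len_gen[OF s, of "sum_list u"] u s by (auto simp: red_def split: if_splits)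
qed

lemma red_rev:
  assumes "red u" shows "red (rev u)" "sum_list (rev u) = - sum_list u"
proof -
  have *: "u \<in> lists S \<Longrightarrow> sum_list (rev u) = - sum_list u" for u
    by (induction u) (auto simp: minus_add)
  then show "sum_list (rev u) = - sum_list u" using assms by (auto simp: red_def)
  then show "red (rev u)" using assms by (auto simp: red_def)
qed

lemma even_len_gen: "s \<in> S \<Longrightarrow> even (len (s + w)) \<longleftrightarrow> odd (len w)"
  using ldesc_len[of s w] not_ldesc_len[of s w] by (metis even_Suc)

lemma len_parity: "u \<in> lists S \<Longrightarrow> even (len (sum_list u)) \<longleftrightarrow> even (length u)"
proof (induction u)
  case (Cons a u)
  then have "a \<in> S" "u \<in> lists S" by auto
  with Cons.IH even_len_gen[of a "sum_list u"] show ?case by simp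
qed simp

section \<open>The Bruhat order\<close>

lemma bruhat_le_refl [simp]: "bruhat_le S x x"
  by (simp add: bruhat_le_def)

lemma bruhat_le_trans: "bruhat_le S x y \<Longrightarrow> bruhat_le S y z \<Longrightarrow> bruhat_le S x z"
  unfolding bruhat_le_def by (rule rtranclp_trans)

lemma bruhat_le_step: "t \<in> reflections S \<Longrightarrow> len x < len (t + x) \<Longrightarrow> bruhat_le S x (t + x)"
  unfolding bruhat_le_def by (rule r_into_rtranclp) auto

lemma bruhat_le_len: "bruhat_le S x y \<Longrightarrow> x = y \<or> len x < len y"
  unfolding bruhat_le_def by (induction rule: rtranclp_induct) auto

lemma bruhat_less_gen_iff: "s \<in> S \<Longrightarrow> bruhat_less S w (s + w) \<longleftrightarrow> \<not> ldesc s w"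
  using bruhat_le_step[OF gen_reflection, of s w] bruhat_le_len[of w "s + w"] not_ldesc_iff[of s w]
  by (auto simp: bruhat_less_def)

lemma bruhat_less_gen_iff': "s \<in> S \<Longrightarrow> bruhat_less S (s + w) w \<longleftrightarrow> ldesc s w"
  using bruhat_less_gen_iff[of s "s + w"] ldesc_gen_self[of s w] by simp

text \<open>The conjugate of \<open>t\<close> by \<open>s\<close> is the reflection leading from
  \<open>s + x\<close> to \<open>s + (t + x)\<close>, and it still raises the length unless
  \<open>t = s\<close>.\<close>

lemma bruhat_step_gen:
  assumes s: "s \<in> S" and t: "t \<in> reflections S" and less: "len x < len (t + x)"
  shows "bruhat_le S (s + x) (t + x) \<or> bruhat_le S (s + x) (s + (t + x))"
proof (cases "ldesc s x")
  case True
  then have "bruhat_le S (s + x) x"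
    using bruhat_le_step[OF gen_reflection[OF s], of "s + x"] s by simp
  then show ?thesis using bruhat_le_step[OF t less] bruhat_le_trans by blast
next
  case False
  show ?thesis
  proof (cases "t = s")
    case False
    let ?t = "s + t - s"
    have t': "?t \<in> reflections S" by (rule reflection_conj[OF t])
    have "?t \<noteq> s"
    proof
      assume "?t = s"
      then have "s + (s + t - s) + s = s + s + s" by simp
      then show False using s False by (simp add: add.assoc diff_conv_add_uminus)
    qed
    have "\<not> inv_set x t" using less len_refl_iff(2)[OF t] by blast
    then have "\<not> inv_set (s + x) ?t"
      using inv_set_gen[OF s, of x ?t] \<open>?t \<noteq> s\<close> s by (simp add: add.assoc diff_conv_add_uminus)
    then have "len (s + x) < len (?t + (s + x))" using len_refl_iff(2)[OF t'] by blast
    from bruhat_le_step[OF t' this] show ?thesis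
      using s by (simp add: group_normalize del: add_uminus_conv_diff)
  qed simp
qed

text \<open>The lifting property. Along a chain from \<open>x\<close> to \<open>w\<close>, the
  element \<open>s + x\<close> stays below the current element or below its image under
  \<open>s\<close>; at \<open>w\<close>, both lie below \<open>s + w\<close>.\<close>

lemma bruhat_le_lift:
  assumes s: "s \<in> S" and "bruhat_le S x w" and "\<not> ldesc s w"
  shows "bruhat_le S (s + x) (s + w)"
proof -
  have "bruhat_le S (s + x) w \<or> bruhat_le S (s + x) (s + w)"
    using assms(2) unfolding bruhat_le_def
  proof (induction rule: rtranclp_induct)
    case (step y z)
    then have "bruhat_le S (s + y) z \<or> bruhat_le S (s + y) (s + z)" "bruhat_le S y z"
      using bruhat_step_gen[OF s, of _ y] bruhat_le_step by blast+
    with step.IH show ?case unfolding bruhat_le_def by (meson rtranclp_trans)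
  qed simp
  moreover have "bruhat_le S w (s + w)"
    using bruhat_less_gen_iff[OF s, of w] assms(3) by (simp add: bruhat_less_def)
  ultimately show ?thesis using bruhat_le_trans by blast
qed

end

section \<open>Laurent polynomials\<close>

abbreviation lookup where "lookup \<equiv> Poly_Mapping.lookup"
abbreviation keys where "keys \<equiv> Poly_Mapping.keys"

lemma poly_mapping_expand:
  "p = (\<Sum>k\<in>keys p. Poly_Mapping.single k (lookup p k))"
  by (rule poly_mapping_eqI) (simp add: lookup_sum lookup_single when_def in_keys_iff)

lemma poly_mapping_induct [case_names single add]:
  fixes p :: "'a \<Rightarrow>\<^sub>0 'b::comm_monoid_add"
  assumes single: "\<And>k a. P (Poly_Mapping.single k a)" and add: "\<And>p q. P p \<Longrightarrow> P q \<Longrightarrow> P (p + q)"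
  shows "P p"
proof -
  have zero: "P 0" using single[of undefined 0] by simp
  have "P (\<Sum>k\<in>A. Poly_Mapping.single k (f k))" if "finite A" for A :: "'a set" and f
    using that by (induction rule: finite_induct) (auto intro: zero single add)
  from this[OF finite_keys] show ?thesis by (subst poly_mapping_expand) blast
qed

lemma lookup_qhalf: "lookup (qhalf k) j = (if j = k then 1 else 0)"
  by (simp add: qhalf_def lookup_single when_def)

lemma qhalf_add: "qhalf a * qhalf b = qhalf (a + b)"
  by (simp add: qhalf_def mult_single)

lemma qhalf_0 [simp]: "qhalf 0 = 1"
  by (simp add: qhalf_def)

lemma lookup_single_mult:
  "lookup (Poly_Mapping.single a c * p) (j::int) = c * lookup p (j - a)"
  by (induction p rule: poly_mapping_induct)
    (auto simp: mult_single lookup_single when_def ring_distribs lookup_add)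

lemma lookup_qhalf_mult [simp]: "lookup (qhalf a * p) j = lookup p (j - a)"
  by (simp add: qhalf_def lookup_single_mult)

lemma lookup_laurent_bar: "lookup (laurent_bar p) k = lookup p (- k)"
  by (simp add: laurent_bar_def Poly_Mapping.map_key.rep_eq)

lemma laurent_bar_add [simp]: "laurent_bar (p + q) = laurent_bar p + laurent_bar q"
  by (rule poly_mapping_eqI) (simp add: lookup_laurent_bar lookup_add)

lemma laurent_bar_diff [simp]: "laurent_bar (p - q) = laurent_bar p - laurent_bar q"
  by (rule poly_mapping_eqI) (simp add: lookup_laurent_bar lookup_minus)

lemma laurent_bar_single [simp]:
  "laurent_bar (Poly_Mapping.single k a) = Poly_Mapping.single (- k) a"
  by (rule poly_mapping_eqI) (auto simp: lookup_laurent_bar lookup_single when_def)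

lemma laurent_bar_0 [simp]: "laurent_bar 0 = 0"
  by (rule poly_mapping_eqI) (simp add: lookup_laurent_bar)

lemma laurent_bar_1 [simp]: "laurent_bar 1 = 1"
  using laurent_bar_single[of 0 1] by simp

lemma laurent_bar_qhalf [simp]: "laurent_bar (qhalf k) = qhalf (- k)"
  by (simp add: qhalf_def)

lemma laurent_bar_bar [simp]: "laurent_bar (laurent_bar p) = p"
  by (rule poly_mapping_eqI) (simp add: lookup_laurent_bar)

lemma laurent_bar_mult [simp]: "laurent_bar (p * q) = laurent_bar p * laurent_bar q"
proof (induction p rule: poly_mapping_induct)
  case (single k a)
  show ?case
    by (rule poly_mapping_eqI) (simp add: lookup_laurent_bar lookup_single_mult)
qed (simp add: ring_distribs)

lemma laurent_at_one_superset: "finite A \<Longrightarrow> keys p \<subseteq> A \<Longrightarrow> laurent_at_one p = (\<Sum>k\<in>A. lookup p k)"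
  unfolding laurent_at_one_def by (rule sum.mono_neutral_left) (auto simp: in_keys_iff)

lemma laurent_at_one_add [simp]:
  "laurent_at_one (p + q) = laurent_at_one p + laurent_at_one q"
proof -
  let ?A = "keys p \<union> keys q"
  have "keys (p + q) \<subseteq> ?A" by (rule keys_add)
  then show ?thesis
    by (simp add: laurent_at_one_superset[of ?A] lookup_add sum.distrib)
qed

lemma laurent_at_one_single [simp]: "laurent_at_one (Poly_Mapping.single k a) = a"
  by (simp add: laurent_at_one_def)

lemma laurent_at_one_0 [simp]: "laurent_at_one 0 = 0"
  by (simp add: laurent_at_one_def)

lemma laurent_at_one_1 [simp]: "laurent_at_one 1 = 1"
  using laurent_at_one_single[of 0 1] by simp

lemma laurent_at_one_qhalf [simp]: "laurent_at_one (qhalf k) = 1"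
  by (simp add: qhalf_def)

lemma laurent_at_one_uminus [simp]: "laurent_at_one (- p) = - laurent_at_one p"
  using laurent_at_one_add[of p "- p"] by (simp add: eq_neg_iff_add_eq_0 add.commute del: laurent_at_one_add)

lemma laurent_at_one_diff [simp]: "laurent_at_one (p - q) = laurent_at_one p - laurent_at_one q"
  using laurent_at_one_add[of p "- q"] by simp

lemma laurent_at_one_mult [simp]:
  "laurent_at_one (p * q) = laurent_at_one p * laurent_at_one q"
proof (induction p rule: poly_mapping_induct)
  case (single k a)
  show ?case
    by (induction q rule: poly_mapping_induct) (simp_all add: mult_single ring_distribs)
qed (simp add: ring_distribs)

section \<open>The free module on a Coxeter group\<close>

abbreviation T where "T \<equiv> hecke_T"
abbreviation hecke_hom :: "('a hecke \<Rightarrow> 'b hecke) \<Rightarrow> bool" where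
  "hecke_hom \<equiv> module_hom hecke_scale hecke_scale"

lemma lookup_T: "lookup (T w) y = (if y = w then 1 else 0)"
  by (simp add: hecke_T_def lookup_single when_def)

lemma keys_hecke_scale: "keys (hecke_scale c h) \<subseteq> keys h"
  by (auto simp: in_keys_iff lookup_hecke_scale)

lemma hecke_scale_T: "hecke_scale c (T w) = Poly_Mapping.single w c"
  by (rule poly_mapping_eqI) (simp add: lookup_hecke_scale lookup_T lookup_single when_def)

lemma hecke_expand: "x = (\<Sum>w\<in>keys x. hecke_scale (lookup x w) (T w))"
  unfolding hecke_scale_T by (rule poly_mapping_expand)

lemma hecke_additive_eqI:
  assumes "\<And>x y. f (x + y) = f x + f y" "\<And>x y. g (x + y) = g x + g y"
    and "\<And>c w. f (hecke_scale c (T w)) = g (hecke_scale c (T w))"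
  shows "f x = g x"
  by (induction x rule: poly_mapping_induct) (simp_all add: assms flip: hecke_scale_T)

lemma hecke_hom_iff:
  "hecke_hom f \<longleftrightarrow> (\<forall>x y. f (x + y) = f x + f y) \<and> (\<forall>c x. f (hecke_scale c x) = hecke_scale c (f x))"
  by (auto simp: module_hom_iff hecke.module_axioms)

lemma hecke_hom_eqI: "hecke_hom f \<Longrightarrow> hecke_hom g \<Longrightarrow> (\<And>w. f (T w) = g (T w)) \<Longrightarrow> f x = g x"
  by (rule hecke_additive_eqI) (auto simp: hecke_hom_iff)

lemma hecke_hom_comp: "hecke_hom f \<Longrightarrow> hecke_hom g \<Longrightarrow> hecke_hom (\<lambda>x. f (g x))"
  by (simp add: hecke_hom_iff)

definition lext :: "('a \<Rightarrow> 'b hecke) \<Rightarrow> 'a hecke \<Rightarrow> 'b hecke" where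
  "lext f x = (\<Sum>w\<in>keys x. hecke_scale (lookup x w) (f w))"

lemma lext_superset:
  "finite A \<Longrightarrow> keys x \<subseteq> A \<Longrightarrow> lext f x = (\<Sum>w\<in>A. hecke_scale (lookup x w) (f w))"
  unfolding lext_def by (rule sum.mono_neutral_left) (auto simp: in_keys_iff)

lemma lext_hom: "hecke_hom (lext f)"
proof -
  have "lext f (x + y) = lext f x + lext f y" for x y
  proof -
    let ?A = "keys x \<union> keys y"
    have "keys (x + y) \<subseteq> ?A" by (rule keys_add)
    then show ?thesis
      by (simp add: lext_superset[of ?A] lookup_add hecke.scale_left_distrib sum.distrib)
  qed
  moreover have "lext f (hecke_scale c x) = hecke_scale c (lext f x)" for c x
    using keys_hecke_scale[of c x]
    by (simp add: lext_superset[of "keys x"] lookup_hecke_scale hecke.scale_sum_right)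
  ultimately show ?thesis by (simp add: hecke_hom_iff)
qed

lemma lext_T [simp]: "lext f (T w) = f w"
  by (simp add: lext_superset[of "{w}"] lookup_T hecke_T_def)

lemma lext_hom2:
  assumes "\<And>w. hecke_hom (f w)"
  shows "hecke_hom (\<lambda>y. lext (\<lambda>w. f w y) x)"
  using assms unfolding hecke_hom_iff lext_def
  by (simp add: hecke.scale_right_distrib sum.distrib hecke.scale_sum_right mult.commute)

definition xi :: laurent where
  "xi = qhalf 1 - qhalf (- 1)"

section \<open>Existence and uniqueness of the Hecke algebra\<close>

context coxeter
begin

lemma gen_diff [simp]: "s \<in> S \<Longrightarrow> w - s = w + s"
  using gen_minus[of s] by (metis diff_conv_add_uminus)

abbreviation rdesc :: "'w \<Rightarrow> 'w \<Rightarrow> bool" where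
  "rdesc t w \<equiv> len (w + t) < len w"

section \<open>Left and right multiplication operators and the product built from them\<close>

definition lmul :: "'w \<Rightarrow> 'w hecke \<Rightarrow> 'w hecke" where
  "lmul s = lext (\<lambda>w. T (s + w) + (if ldesc s w then hecke_scale xi (T w) else 0))"

definition rmul :: "'w \<Rightarrow> 'w hecke \<Rightarrow> 'w hecke" where
  "rmul t = lext (\<lambda>w. T (w + t) + (if rdesc t w then hecke_scale xi (T w) else 0))"

lemma lmul_hom: "hecke_hom (lmul s)" and rmul_hom: "hecke_hom (rmul t)"
  unfolding lmul_def rmul_def by (rule lext_hom)+

lemma lmul_T: "lmul s (T w) = T (s + w) + (if ldesc s w then hecke_scale xi (T w) else 0)"
  and rmul_T: "rmul t (T w) = T (w + t) + (if rdesc t w then hecke_scale xi (T w) else 0)"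
  by (simp_all add: lmul_def rmul_def)

lemmas lmul_linear = lmul_hom[unfolded hecke_hom_iff, THEN conjunct1, rule_format]
  lmul_hom[unfolded hecke_hom_iff, THEN conjunct2, rule_format]
lemmas rmul_linear = rmul_hom[unfolded hecke_hom_iff, THEN conjunct1, rule_format]
  rmul_hom[unfolded hecke_hom_iff, THEN conjunct2, rule_format]

lemma if_not_swap: "(if \<not> P then a else b) = (if P then b else a)"
  by simp

lemma lmul_0 [simp]: "lmul s 0 = 0" and rmul_0 [simp]: "rmul s 0 = 0"
  by (simp_all add: lmul_def rmul_def lext_def)

text \<open>Either \<open>s + w = w + t\<close>, and both products agree term by term, or by
  \<open>gen_conj_eq\<close> neither multiplication affects the descent that decides the other
  one.\<close>

lemma lmul_rmul:
  assumes s: "s \<in> S" and t: "t \<in> S"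
  shows "lmul s (rmul t x) = rmul t (lmul s x)"
proof (rule hecke_hom_eqI[where f = "\<lambda>x. lmul s (rmul t x)" and g = "\<lambda>x. rmul t (lmul s x)"])
  fix w
  show "lmul s (rmul t (T w)) = rmul t (lmul s (T w))"
  proof (cases "s + w = w + t")
    case True
    have 1: "s + (w + t) = w" using s by (simp flip: True)
    have 2: "w + t + t = w" using t by simp
    define D where "D = ldesc s w"
    have d: "ldesc s (w + t) \<longleftrightarrow> \<not> D" "rdesc t (w + t) \<longleftrightarrow> \<not> D" "rdesc t w \<longleftrightarrow> D"
      using ldesc_gen_self[OF s, of w] rdesc_gen_self[OF t, of w] by (simp_all only: True D_def)
    have "lmul s (T (w + t)) = T w + (if D then 0 else hecke_scale xi (T (w + t)))"
      "rmul t (T (w + t)) = T w + (if D then 0 else hecke_scale xi (T (w + t)))"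
      by (simp_all only: lmul_T rmul_T d) (simp_all only: 1 2 if_not_swap)
    moreover have "rmul t (T w) = T (w + t) + (if D then hecke_scale xi (T w) else 0)"
      by (simp only: rmul_T d)
    moreover have "lmul s (T w) = T (w + t) + (if D then hecke_scale xi (T w) else 0)"
      by (simp only: lmul_T D_def[symmetric]) (simp only: True)
    ultimately show ?thesis
      by (simp add: lmul_linear rmul_linear)
  next
    case False
    have l: "ldesc s (w + t) \<longleftrightarrow> ldesc s w" using gen_conj_eq[OF s t] False by blast
    have "t + - w = - w + s \<longleftrightarrow> - (t + - w) = - (- w + s)"
      by (simp only: neg_equal_iff_equal)
    also have "\<dots> \<longleftrightarrow> w + t = s + w" using s t by (simp add: minus_add)
    finally have "ldesc t (- w + s) \<longleftrightarrow> ldesc t (- w)"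
      using gen_conj_eq[OF t s, of "- w"] False by auto
    moreover have "- (s + w) = - w + s" using s by (simp add: minus_add)
    ultimately have r: "rdesc t (s + w) \<longleftrightarrow> rdesc t w"
      using len_uminus[of w] len_uminus[of "s + w"]
      by (simp add: len_gen_right[OF t] del: len_uminus)
    have "lmul s (rmul t (T w)) = T (s + w + t) + (if ldesc s w then hecke_scale xi (T (w + t)) else 0)
        + (if rdesc t w then hecke_scale xi (lmul s (T w)) else 0)"
      by (cases "rdesc t w") (simp_all only: rmul_T if_True if_False lmul_linear add_0_right lmul_T l add.assoc)
    moreover have "rmul t (lmul s (T w)) = T (s + w + t) + (if rdesc t w then hecke_scale xi (T (s + w)) else 0)
        + (if ldesc s w then hecke_scale xi (rmul t (T w)) else 0)"
      by (cases "ldesc s w") (simp_all only: lmul_T if_True if_False rmul_linear add_0_right rmul_T r)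
    ultimately show ?thesis
      by (cases "ldesc s w"; cases "rdesc t w")
        (simp_all only: lmul_T rmul_T if_True if_False hecke.scale_right_distrib hecke.scale_zero_right add_0_right add_0_left add_ac)
  qed
qed (rule hecke_hom_comp[OF lmul_hom rmul_hom] hecke_hom_comp[OF rmul_hom lmul_hom])+

definition lword :: "'w list \<Rightarrow> 'w hecke \<Rightarrow> 'w hecke" where
  "lword u y = foldr lmul u y"

lemma lword_simps [simp]: "lword [] y = y" "lword (s # u) y = lmul s (lword u y)"
  by (simp_all add: lword_def)

lemma lword_hom: "hecke_hom (lword u)"
  by (induction u) (simp_all add: hecke_hom_iff lmul_linear)

lemma lword_rmul: "u \<in> lists S \<Longrightarrow> t \<in> S \<Longrightarrow> lword u (rmul t x) = rmul t (lword u x)"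
  by (induction u) (simp_all add: lmul_rmul)

lemma lword_T0: "red u \<Longrightarrow> lword u (T 0) = T (sum_list u)"
proof (induction u)
  case (Cons s u)
  then show ?case using red_ConsD[OF Cons.prems] by (simp add: lmul_T)
qed simp

definition red_word :: "'w \<Rightarrow> 'w list" where
  "red_word w = (SOME u. red u \<and> sum_list u = w)"

lemma red_word: "red (red_word w)" "sum_list (red_word w) = w" "red_word w \<in> lists S"
  using someI_ex[OF exists_red[of w]] by (auto simp: red_word_def red_def)

lemma red_word_0 [simp]: "red_word 0 = []"
  using red_word[of 0] by (simp add: red_def)

lemma red_word_gen [simp]: assumes "s \<in> S" shows "red_word s = [s]"
proof -
  have "length (red_word s) = 1" using red_word[of s] assms by (simp add: red_def)
  then obtain a where "red_word s = [a]" by (auto simp: length_Suc_conv)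
  with red_word(2)[of s] show ?thesis by simp
qed

text \<open>A reduced word is chosen for each \<open>w\<close>. The choice is harmless: an operator
  that commutes with all \<open>rmul t\<close> is determined by its value at \<open>T 0\<close>,
  which is \<open>T w\<close> for every reduced word of \<open>w\<close>.\<close>

definition hmul :: "'w hecke \<Rightarrow> 'w hecke \<Rightarrow> 'w hecke" where
  "hmul x y = lext (\<lambda>w. lword (red_word w) y) x"

lemma hmul_hom_right: "hecke_hom (\<lambda>y. hmul x y)"
  unfolding hmul_def by (rule lext_hom2) (rule lword_hom)

lemma hmul_hom_left: "hecke_hom (\<lambda>x. hmul x y)"
  unfolding hmul_def by (rule lext_hom)

lemma hmul_T: "hmul (T w) y = lword (red_word w) y"
  by (simp add: hmul_def)

lemma hmul_one_right: "hmul x (T 0) = x"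
  by (rule hecke_hom_eqI[OF hmul_hom_left]) (simp_all add: hmul_T lword_T0 red_word hecke_hom_iff)

lemma hmul_rmul: "t \<in> S \<Longrightarrow> hmul x (rmul t y) = rmul t (hmul x y)"
  by (rule hecke_hom_eqI[where f = "\<lambda>x. hmul x (rmul t y)" and g = "\<lambda>x. rmul t (hmul x y)"])
    (auto intro: hmul_hom_left hecke_hom_comp[OF rmul_hom hmul_hom_left] simp: hmul_T lword_rmul red_word)

text \<open>\<open>T 0\<close> generates the module under right multiplications. Associativity is an
  instance: both sides commute with every \<open>rmul t\<close> in the last argument.\<close>

lemma right_module_eqI:
  assumes hom: "hecke_hom f" "hecke_hom g"
    and comm: "\<And>t x. t \<in> S \<Longrightarrow> f (rmul t x) = rmul t (f x)"
      "\<And>t x. t \<in> S \<Longrightarrow> g (rmul t x) = rmul t (g x)"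
    and one: "f (T 0) = g (T 0)"
  shows "f x = g x"
proof (rule hecke_hom_eqI[OF hom])
  \<comment> \<open>\<open>len_induct\<close> adds letters on the left; negation turns them into
    right factors.\<close>
  have "f (T (- w)) = g (T (- w))" for w
  proof (induction w rule: len_induct)
    case (gen s w)
    have "\<not> rdesc s (- w)" using gen by (simp add: len_gen_right)
    then have "T (- (s + w)) = rmul s (T (- w))"
      using gen by (simp add: rmul_T minus_add del: add_uminus_conv_diff)
    then show ?case using gen comm by simp
  qed (simp add: one)
  from this[of "- w" for w] show "f (T w) = g (T w)" for w by simp
qed

lemma hmul_assoc: "hmul (hmul x y) z = hmul x (hmul y z)"
  by (rule right_module_eqI[where f = "\<lambda>z. hmul (hmul x y) z" and g = "\<lambda>z. hmul x (hmul y z)"])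
    (simp_all add: hmul_rmul hmul_one_right hecke_hom_comp[OF hmul_hom_right] hmul_hom_right)

lemma is_hecke_mult_hmul: "is_hecke_mult S hmul"
  unfolding is_hecke_mult_def
  using hmul_hom_right hmul_hom_left hmul_assoc hmul_one_right
  by (auto simp: hmul_T lmul_T bruhat_less_gen_iff bruhat_less_gen_iff' xi_def add.commute)

lemma is_hecke_mult_lmul:
  assumes m: "is_hecke_mult S m" and s: "s \<in> S"
  shows "m (T s) y = lmul s y"
proof (rule hecke_hom_eqI[OF _ lmul_hom])
  show "hecke_hom (m (T s))" using m by (auto simp: is_hecke_mult_def)
  show "m (T s) (T w) = lmul s (T w)" for w
    using m s unfolding is_hecke_mult_def
    by (cases "ldesc s w")
      (simp_all add: lmul_T bruhat_less_gen_iff bruhat_less_gen_iff' xi_def add.commute)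
qed

lemma is_hecke_mult_unique:
  assumes m: "is_hecke_mult S m"
  shows "m = hmul"
proof (intro ext)
  fix x y
  have word: "m (T (sum_list u)) y = lword u y" if "red u" for u
    using that
  proof (induction u)
    case Nil
    then show ?case using m by (simp add: is_hecke_mult_def)
  next
    case (Cons s u)
    note red_ConsD[OF Cons.prems]
    then have "T (sum_list (s # u)) = m (T s) (T (sum_list u))"
      using is_hecke_mult_lmul[OF m] by (simp add: lmul_T)
    then have "m (T (sum_list (s # u))) y = m (T s) (m (T (sum_list u)) y)"
      using m by (simp add: is_hecke_mult_def)
    with Cons.IH red_ConsD[OF Cons.prems] is_hecke_mult_lmul[OF m] show ?case by simp
  qed
  show "m x y = hmul x y"
  proof (rule hecke_hom_eqI[OF _ hmul_hom_left])
    show "hecke_hom (\<lambda>x. m x y)" using m by (simp add: is_hecke_mult_def)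
    show "m (T w) y = hmul (T w) y" for w
      using word[OF red_word(1)[of w]] by (simp add: red_word hmul_T)
  qed
qed

lemma hecke_mult_eq: "hecke_mult S = hmul"
  unfolding hecke_mult_def
  by (rule the_equality) (fact is_hecke_mult_hmul, erule is_hecke_mult_unique)

abbreviation hecke_times (infixl \<open>\<star>\<close> 70) where
  "x \<star> y \<equiv> hecke_mult S x y"

lemma hecke_linear [simp]:
  "(x + x') \<star> y = x \<star> y + x' \<star> y" "x \<star> (y + y') = x \<star> y + x \<star> y'"
  "hecke_scale c x \<star> y = hecke_scale c (x \<star> y)" "x \<star> hecke_scale c y = hecke_scale c (x \<star> y)"
  using hmul_hom_left hmul_hom_right unfolding hecke_mult_eq hecke_hom_iff by blast+

lemma hecke_hom_left: "hecke_hom (\<lambda>x. x \<star> y)" and hecke_hom_right: "hecke_hom (\<lambda>y. x \<star> y)"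
  by (simp_all add: hecke_hom_iff)

lemmas hecke_mult_diff [simp] =
  module_hom.diff[OF hecke_hom_left] module_hom.diff[OF hecke_hom_right]
lemmas hecke_mult_uminus [simp] =
  module_hom.neg[OF hecke_hom_left] module_hom.neg[OF hecke_hom_right]
lemmas hecke_mult_sum =
  module_hom.sum[OF hecke_hom_left] module_hom.sum[OF hecke_hom_right]

lemma hecke_assoc: "(x \<star> y) \<star> z = x \<star> (y \<star> z)"
  unfolding hecke_mult_eq by (rule hmul_assoc)

lemma hecke_one [simp]: "T 0 \<star> x = x" "x \<star> T 0 = x"
  unfolding hecke_mult_eq by (simp_all add: hmul_T hmul_one_right)

lemma T_mult_left: "s \<in> S \<Longrightarrow> T s \<star> x = lmul s x"
  unfolding hecke_mult_eq by (rule is_hecke_mult_lmul[OF is_hecke_mult_hmul])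

lemma T_mult_right: "t \<in> S \<Longrightarrow> x \<star> T t = rmul t x"
  using hmul_rmul[of t x "T 0"] rmul_T[of t 0] by (simp add: hecke_mult_eq hmul_one_right)

lemma T_add: "s \<in> S \<Longrightarrow> \<not> ldesc s w \<Longrightarrow> T (s + w) = T s \<star> T w"
  by (simp add: T_mult_left lmul_T)

lemma T_add_right: "s \<in> S \<Longrightarrow> \<not> rdesc s w \<Longrightarrow> T (w + s) = T w \<star> T s"
  by (simp add: T_mult_right rmul_T)

lemma T_square: "s \<in> S \<Longrightarrow> T s \<star> T s = hecke_scale xi (T s) + T 0"
  by (simp add: T_mult_left lmul_T add.commute)

section \<open>The bar involution\<close>

definition Tinv :: "'w \<Rightarrow> 'w hecke" where
  "Tinv s = T s - hecke_scale xi (T 0)"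

lemma Tinv: assumes "s \<in> S" shows "T s \<star> Tinv s = T 0" "Tinv s \<star> T s = T 0"
  using T_square[OF assms] by (simp_all add: Tinv_def)

definition is_inv :: "'w hecke \<Rightarrow> 'w hecke \<Rightarrow> bool" where
  "is_inv x y \<longleftrightarrow> x \<star> y = T 0 \<and> y \<star> x = T 0"

lemma is_inv_unique: "is_inv x y \<Longrightarrow> is_inv x' y \<Longrightarrow> x = x'"
  unfolding is_inv_def by (metis hecke_assoc hecke_one)

lemma is_inv_mult:
  assumes "is_inv x y" "is_inv x' y'" shows "is_inv (x \<star> x') (y' \<star> y)"
proof -
  have "x \<star> x' \<star> (y' \<star> y) = x \<star> (x' \<star> y') \<star> y" "y' \<star> y \<star> (x \<star> x') = y' \<star> (y \<star> x) \<star> x'"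
    by (simp_all add: hecke_assoc)
  then show ?thesis using assms by (simp add: is_inv_def)
qed

lemma Tinv_is_inv: "s \<in> S \<Longrightarrow> is_inv (Tinv s) (T s)"
  by (simp add: is_inv_def Tinv)

lemma T_minus_gen: "s \<in> S \<Longrightarrow> \<not> ldesc s w \<Longrightarrow> T (- (s + w)) = T (- w) \<star> T s"
  using T_add_right[of s "- w"] by (simp add: minus_add len_gen_right del: add_uminus_conv_diff)

lemma exists_is_inv: "\<exists>x. is_inv x (T (- w))"
proof (induction w rule: len_induct)
  case zero
  then show ?case by (intro exI[of _ "T 0"]) (simp add: is_inv_def)
next
  case (gen s w)
  then show ?case using is_inv_mult[OF Tinv_is_inv[of s]] T_minus_gen[of s w] by auto
qed

text \<open>Taking the inverse of \<open>T (- w)\<close> instead of a product over a reduced word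
  makes the value independent of choices; the product rule \<open>T_bar_gen_add\<close> then follows
  from uniqueness of inverses.\<close>

definition T_bar :: "'w \<Rightarrow> 'w hecke" where
  "T_bar w = (SOME x. is_inv x (T (- w)))"

lemma T_bar_is_inv: "is_inv (T_bar w) (T (- w))"
  unfolding T_bar_def by (rule someI_ex[OF exists_is_inv])

lemma T_bar_eqI: "is_inv x (T (- w)) \<Longrightarrow> T_bar w = x"
  by (rule is_inv_unique[OF T_bar_is_inv])

lemma T_bar_0 [simp]: "T_bar 0 = T 0"
  by (rule T_bar_eqI) (simp add: is_inv_def)

lemma T_bar_gen_add: "s \<in> S \<Longrightarrow> \<not> ldesc s w \<Longrightarrow> T_bar (s + w) = Tinv s \<star> T_bar w"
  using is_inv_mult[OF Tinv_is_inv T_bar_is_inv, of s w]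
  by (intro T_bar_eqI) (simp add: T_minus_gen)

lemma T_bar_gen: "s \<in> S \<Longrightarrow> T_bar s = Tinv s"
  using T_bar_gen_add[of s 0] by simp

definition coef_bar :: "'w hecke \<Rightarrow> 'w hecke" where
  "coef_bar x = Poly_Mapping.map laurent_bar x"

lemma lookup_coef_bar: "lookup (coef_bar x) w = laurent_bar (lookup x w)"
  by (simp add: coef_bar_def Poly_Mapping.map.rep_eq when_def)

lemma coef_bar_simps [simp]:
  "coef_bar (x + y) = coef_bar x + coef_bar y"
  "coef_bar (hecke_scale c x) = hecke_scale (laurent_bar c) (coef_bar x)"
  "coef_bar (T w) = T w"
  by (auto intro!: poly_mapping_eqI simp: lookup_coef_bar lookup_add lookup_hecke_scale lookup_T)

definition bar :: "'w hecke \<Rightarrow> 'w hecke" where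
  "bar x = lext T_bar (coef_bar x)"

lemma bar_add [simp]: "bar (x + y) = bar x + bar y"
  and bar_scale [simp]: "bar (hecke_scale c x) = hecke_scale (laurent_bar c) (bar x)"
  and bar_T: "bar (T w) = T_bar w"
  using lext_hom[of T_bar] by (simp_all add: bar_def hecke_hom_iff)

lemma bar_additive: "additive bar"
  by (simp add: additive_def)

lemmas bar_diff [simp] = additive.diff[OF bar_additive]
lemmas bar_sum = additive.sum[OF bar_additive]

lemma laurent_bar_xi [simp]: "laurent_bar xi = - xi"
  by (simp add: xi_def)

lemma bar_T_gen_mult: assumes s: "s \<in> S" shows "bar (T s \<star> y) = Tinv s \<star> bar y"
proof (rule hecke_additive_eqI[where f = "\<lambda>y. bar (T s \<star> y)" and g = "\<lambda>y. Tinv s \<star> bar y"])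
  fix c w
  have "bar (T s \<star> T w) = Tinv s \<star> T_bar w"
  proof (cases "ldesc s w")
    case True
    define u where "u = s + w"
    have w: "w = s + u" and u: "\<not> ldesc s u" using True s by (auto simp: u_def)
    \<comment> \<open>The quadratic relation for \<open>Tinv s\<close>: that of \<open>T s\<close>,
      with \<open>xi\<close> replaced by its bar image \<open>- xi\<close>.\<close>
    have "Tinv s \<star> Tinv s = T 0 - hecke_scale xi (Tinv s)"
      using T_square[OF s] by (simp add: Tinv_def hecke.scale_right_diff_distrib)
    then have "Tinv s \<star> (Tinv s \<star> T_bar u) = T_bar u - hecke_scale xi (Tinv s \<star> T_bar u)"
      by (simp flip: hecke_assoc)
    moreover have "T s \<star> T w = T u + hecke_scale xi (T w)"
      using s True by (simp add: T_mult_left lmul_T u_def)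
    ultimately show ?thesis
      using T_bar_gen_add[OF s u] by (simp add: bar_T w)
  next
    case False
    then show ?thesis using s by (simp add: bar_T T_bar_gen_add flip: T_add)
  qed
  then show "bar (T s \<star> hecke_scale c (T w)) = Tinv s \<star> bar (hecke_scale c (T w))"
    by (simp add: bar_T)
qed simp_all

lemma bar_mult: "bar (x \<star> y) = bar x \<star> bar y"
proof (rule hecke_additive_eqI[where f = "\<lambda>x. bar (x \<star> y)" and g = "\<lambda>x. bar x \<star> bar y"])
  fix c w
  have "bar (T w \<star> y) = T_bar w \<star> bar y"
  proof (induction w rule: len_induct)
    case (gen s w)
    then show ?case by (simp add: T_add T_bar_gen_add hecke_assoc bar_T_gen_mult)
  qed simp
  then show "bar (hecke_scale c (T w) \<star> y) = bar (hecke_scale c (T w)) \<star> bar y"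
    by (simp add: bar_T)
qed simp_all

lemma bar_bar: "bar (bar x) = x"
proof (rule hecke_additive_eqI[where f = "\<lambda>x. bar (bar x)" and g = "\<lambda>x. x"])
  have s: "bar (Tinv s) = T s" if "s \<in> S" for s
    using that by (simp add: Tinv_def bar_T T_bar_gen)
  have "bar (T_bar w) = T w" for w
  proof (induction w rule: len_induct)
    case (gen s w)
    then show ?case by (simp add: T_bar_gen_add bar_mult s T_add)
  qed (simp add: bar_T)
  then show "bar (bar (hecke_scale c (T w))) = hecke_scale c (T w)" for c w
    by (simp add: bar_T)
qed simp_all

lemma is_hecke_bar_bar: "is_hecke_bar S bar"
  using T_bar_is_inv by (auto simp: is_hecke_bar_def bar_mult bar_bar bar_T is_inv_def)

lemma hecke_bar_eq: "hecke_bar S = bar"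
  unfolding hecke_bar_def
proof (rule the_equality, fact is_hecke_bar_bar)
  fix b assume b: "is_hecke_bar S b"
  then have "b (T w) = bar (T w)" for w
    using T_bar_eqI[of "b (T w)" w] unfolding bar_T is_hecke_bar_def is_inv_def by simp
  moreover have "b (x + y) = b x + b y" "b (hecke_scale c x) = hecke_scale (laurent_bar c) (b x)"
    for x y c using b unfolding is_hecke_bar_def by blast+
  ultimately have "b x = bar x" for x
    by - (rule hecke_additive_eqI[of b bar], simp_all)
  then show "b = bar" by blast
qed

section \<open>Triangularity of the bar involution with respect to length\<close>

definition shorter :: "nat \<Rightarrow> 'w hecke \<Rightarrow> bool" where
  "shorter n x \<longleftrightarrow> (\<forall>y. lookup x y \<noteq> 0 \<longrightarrow> len y < n)"

lemma shorter_intros: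
  "shorter n 0" "shorter n x \<Longrightarrow> shorter n y \<Longrightarrow> shorter n (x + y)"
  "shorter n x \<Longrightarrow> shorter n y \<Longrightarrow> shorter n (x - y)"
  "shorter n x \<Longrightarrow> shorter n (hecke_scale c x)" "len w < n \<Longrightarrow> shorter n (T w)"
  by (auto simp: shorter_def lookup_add lookup_minus lookup_hecke_scale lookup_T)
    (metis add_0 diff_zero)+

lemma shorter_mono: "shorter m x \<Longrightarrow> m \<le> n \<Longrightarrow> shorter n x"
  by (auto simp: shorter_def)

lemma shorter_lmul: assumes "s \<in> S" "shorter n x" shows "shorter (Suc n) (lmul s x)"
proof -
  have "shorter (Suc n) (\<Sum>w\<in>A. hecke_scale (lookup x w) (lmul s (T w)))"
    if "finite A" "A \<subseteq> keys x" for A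
    using that
  proof (induction rule: finite_induct)
    case (insert w A)
    then have "len w < n" using assms(2) by (auto simp: shorter_def in_keys_iff)
    then have "shorter (Suc n) (lmul s (T w))"
      using len_gen[OF assms(1), of w] by (auto simp: lmul_T intro!: shorter_intros)
    then show ?case using insert by (auto intro!: shorter_intros)
  qed (auto intro: shorter_intros)
  moreover have "lmul s x = (\<Sum>w\<in>keys x. hecke_scale (lookup x w) (lmul s (T w)))"
    by (simp add: lmul_T) (simp add: lmul_def lext_def)
  ultimately show ?thesis by simp
qed

lemma bar_T_shorter: "shorter (len w) (bar (T w) - T w)"
proof (induction w rule: len_induct)
  case (gen s w)
  note l = not_ldesc_len[OF gen(1,2)]
  have sh: "shorter (Suc (len w)) (bar (T w))"
    using shorter_intros(2)[OF shorter_mono[OF gen(3), of "Suc (len w)"] shorter_intros(5)[of w "Suc (len w)"]]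
    by simp
  have b: "bar (T (s + w)) = Tinv s \<star> bar (T w)"
    using gen(1,2) by (simp add: bar_T T_bar_gen_add)
  have "bar (T (s + w)) - T (s + w) = lmul s (bar (T w) - T w) - hecke_scale xi (bar (T w))"
    unfolding b using T_add[OF gen(1,2)] gen(1) by (simp add: Tinv_def flip: T_mult_left)
  then show ?case unfolding l using shorter_lmul[OF gen(1,3)] sh by (simp add: shorter_intros)
qed (simp add: bar_T shorter_intros)

end

section \<open>The Kazhdan--Lusztig basis\<close>

abbreviation const :: "complex \<Rightarrow> laurent" where
  "const a \<equiv> Poly_Mapping.single 0 a"

lemma lookup_const_mult [simp]: "lookup (const a * p) (k::int) = a * lookup p k"
  by (simp add: lookup_single_mult)

lemma lookup_sign_mult: "lookup ((- 1) ^ n * p) (k::int) = (- 1) ^ n * lookup (p::laurent) k"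
  by (cases "even n") simp_all

lemma int_poly_at_pCons: "int_poly_at (pCons a p) x = of_int a + x * int_poly_at p x"
  by (simp add: int_poly_at_def map_poly_pCons)

lemma int_poly_at_0 [simp]: "int_poly_at 0 x = 0" and int_poly_at_1 [simp]: "int_poly_at 1 x = 1"
  by (simp_all add: int_poly_at_def)

lemma lookup_int_poly_at:
  assumes "n > 0"
  shows "lookup (int_poly_at p (qhalf n)) j =
    (if n dvd j \<and> 0 \<le> j then of_int (coeff p (nat (j div n))) else 0)"
proof (induction p arbitrary: j rule: pCons_induct)
  case (pCons a p)
  have *: "lookup (int_poly_at (pCons a p) (qhalf n)) j =
      (if j = 0 then of_int a else 0) + lookup (int_poly_at p (qhalf n)) (j - n)"
    by (simp add: int_poly_at_pCons lookup_add lookup_of_int when_def)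
  show ?case
  proof (cases "n dvd j \<and> 0 < j")
    case True
    then obtain m where m: "j = n * m" "m > 0"
      using assms by (metis dvdE zero_less_mult_pos)
    then have "(j - n) div n = m - 1" "j div n = m" "n dvd j - n" "0 \<le> j - n"
      using assms by (simp_all add: div_diff mult_le_cancel_left1)
    moreover have "nat m = Suc (nat (m - 1))" using m by simp
    ultimately show ?thesis using True assms unfolding * pCons.IH by simp
  next
    case False
    then have "\<not> (n dvd j - n \<and> 0 \<le> j - n)" using assms
      by (auto simp: dvd_diff_right_iff) (smt (verit) dvd_add_triv_right_iff)
    then show ?thesis using False assms unfolding * pCons.IH by auto
  qed
qed simp

text \<open>With \<open>d = len w - len y\<close>, this is the shape of
  \<open>q^(d/2) * bar P\<close> for \<open>P\<close> in \<open>\<int>[q]\<close> of degree at most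
  \<open>(d - 1)/2\<close>: the exponents of \<open>q^(1/2)\<close> are \<open>d - 2 i\<close>,
  hence positive, at most \<open>d\<close> and of the parity of \<open>d\<close>.\<close>

definition kl_coef :: "int \<Rightarrow> laurent \<Rightarrow> bool" where
  "kl_coef d c \<longleftrightarrow>
     (\<forall>k. lookup c k \<in> \<int> \<and> (lookup c k \<noteq> 0 \<longrightarrow> 1 \<le> k \<and> k \<le> d \<and> even (d - k)))"

lemma kl_coef_0 [simp]: "kl_coef d 0"
  by (simp add: kl_coef_def)

lemma kl_coef_add:
  assumes "kl_coef d a" "kl_coef d b" shows "kl_coef d (a + b)"
  unfolding kl_coef_def
proof (intro allI)
  fix k
  have "lookup a k \<in> \<int>" "lookup b k \<in> \<int>"
    using assms by (simp_all add: kl_coef_def)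
  moreover have "lookup a k \<noteq> 0 \<or> lookup b k \<noteq> 0" if "lookup (a + b) k \<noteq> 0"
    using that by (auto simp: lookup_add)
  ultimately show "lookup (a + b) k \<in> \<int> \<and>
      (lookup (a + b) k \<noteq> 0 \<longrightarrow> 1 \<le> k \<and> k \<le> d \<and> even (d - k))"
    using assms by (auto simp only: kl_coef_def lookup_add intro: Ints_add)
qed

lemma kl_coef_sum: "(\<And>z. z \<in> A \<Longrightarrow> kl_coef d (f z)) \<Longrightarrow> kl_coef d (sum f A)"
  by (induction A rule: infinite_finite_induct) (auto intro: kl_coef_add)

lemma kl_coef_uminus: "kl_coef d a \<Longrightarrow> kl_coef d (- a)"
  by (simp add: kl_coef_def)

lemma kl_coef_mono:
  assumes "kl_coef d' a" "d' \<le> d" "even (d - d')" shows "kl_coef d a"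
  unfolding kl_coef_def
proof (intro allI conjI impI)
  fix k
  show "lookup a k \<in> \<int>" using assms by (simp add: kl_coef_def)
  assume "lookup a k \<noteq> 0"
  then have "1 \<le> k" "k \<le> d'" "even (d' - k)" using assms by (auto simp: kl_coef_def)
  then show "1 \<le> k" "k \<le> d" "even (d - k)" using assms by auto
qed

lemma kl_coef_shift: "kl_coef d a \<Longrightarrow> kl_coef (d + 1) (qhalf 1 * a)"
  by (force simp: kl_coef_def)

lemma kl_coef_const_mult: "a \<in> \<int> \<Longrightarrow> kl_coef d c \<Longrightarrow> kl_coef d (const a * c)"
  by (auto simp: kl_coef_def)

context coxeter
begin

section \<open>Existence and uniqueness of the basis elements\<close>

definition is_kl :: "'w \<Rightarrow> 'w hecke \<Rightarrow> bool" where
  "is_kl w C \<longleftrightarrow> bar C = C \<and> lookup C w = 1 \<and>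
     (\<forall>y. y \<noteq> w \<longrightarrow> kl_coef (int (len w) - int (len y)) (lookup C y) \<and>
       (lookup C y \<noteq> 0 \<longrightarrow> bruhat_le S y w))"

text \<open>The part of the characterization that already forces uniqueness
  (\<open>weak_kl_unique\<close>).\<close>

definition weak_kl :: "'w \<Rightarrow> 'w hecke \<Rightarrow> bool" where
  "weak_kl w C \<longleftrightarrow> bar C = C \<and> lookup C w = 1 \<and>
     (\<forall>y k. y \<noteq> w \<longrightarrow> k \<le> 0 \<longrightarrow> lookup (lookup C y) k = 0)"

lemma is_kl_imp_weak: "is_kl w C \<Longrightarrow> weak_kl w C"
  unfolding is_kl_def weak_kl_def kl_coef_def by force

lemma exists_longest:
  assumes "finite A" "A \<noteq> {}"
  shows "\<exists>y\<in>A. \<forall>z\<in>A. len z \<le> len y"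
proof -
  have "Max (len ` A) \<in> len ` A" using assms by (intro Max_in) auto
  then obtain y where "y \<in> A" "len y = Max (len ` A)" by auto
  with assms show ?thesis by (intro bexI[of _ y]) simp_all
qed

text \<open>At a longest \<open>y\<close> in the support, triangularity makes the coefficient of
  \<open>bar D\<close> the bar of the coefficient of \<open>D\<close>. This coefficient is then bar
  invariant, which a nonzero Laurent polynomial with only positive exponents cannot be.\<close>

lemma bar_positive_eq_0:
  assumes bar: "bar D = D" and pos: "\<And>y k. k \<le> 0 \<Longrightarrow> lookup (lookup D y) k = 0"
  shows "D = 0"
proof (rule ccontr)
  assume "D \<noteq> 0"
  then have "keys D \<noteq> {}" by (metis poly_mapping_eqI lookup_zero in_keys_iff ex_in_conv)
  then obtain y where y: "y \<in> keys D" "\<And>z. z \<in> keys D \<Longrightarrow> len z \<le> len y"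
    using exists_longest[of "keys D"] finite_keys by blast
  have other: "lookup (bar (T w)) y = (if w = y then 1 else 0)" if "w \<in> keys D" for w
  proof -
    have "lookup (bar (T w) - T w) y = 0"
      using bar_T_shorter[of w] y(2)[OF that] unfolding shorter_def by force
    then show ?thesis by (auto simp: lookup_minus lookup_T split: if_splits)
  qed
  have "bar D = bar (\<Sum>w\<in>keys D. hecke_scale (lookup D w) (T w))"
    using hecke_expand[of D] by simp
  also have "\<dots> = (\<Sum>w\<in>keys D. hecke_scale (laurent_bar (lookup D w)) (bar (T w)))"
    by (simp add: bar_sum)
  finally have D: "bar D = (\<Sum>w\<in>keys D. hecke_scale (laurent_bar (lookup D w)) (bar (T w)))" .
  have "lookup D y = lookup (bar D) y" by (simp add: bar)
  also have "\<dots> = (\<Sum>w\<in>keys D. laurent_bar (lookup D w) * lookup (bar (T w)) y)"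
    unfolding D by (simp add: lookup_sum lookup_hecke_scale)
  also have "\<dots> = (\<Sum>w\<in>keys D. if w = y then laurent_bar (lookup D w) else 0)"
    by (rule sum.cong) (auto simp: other)
  also have "\<dots> = laurent_bar (lookup D y)" using y by simp
  finally have self: "lookup (lookup D y) k = lookup (lookup D y) (- k)" for k
    by (metis lookup_laurent_bar)
  have "lookup (lookup D y) k = 0" for k
    using pos[of k y] pos[of "- k" y] self[of k] by (cases "k \<le> 0") auto
  then have "lookup D y = 0" by (intro poly_mapping_eqI) simp
  with y show False by (simp add: in_keys_iff)
qed

lemma weak_kl_unique:
  assumes "weak_kl w C" "weak_kl w C'" shows "C = C'"
proof -
  have "C - C' = 0"
  proof (rule bar_positive_eq_0)
    show "bar (C - C') = C - C'" using assms by (simp add: weak_kl_def)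
    show "lookup (lookup (C - C') y) k = 0" if "k \<le> 0" for y k
      using assms that by (cases "y = w") (auto simp: weak_kl_def lookup_minus)
  qed
  then show ?thesis by simp
qed

definition cs :: "'w \<Rightarrow> 'w hecke" where
  "cs s = T s - hecke_scale (qhalf 1) (T 0)"

lemma bar_cs: "s \<in> S \<Longrightarrow> bar (cs s) = cs s"
  by (simp add: cs_def bar_T T_bar_gen Tinv_def xi_def hecke.scale_left_diff_distrib)

lemma cs_mult: "s \<in> S \<Longrightarrow> cs s \<star> x = lmul s x - hecke_scale (qhalf 1) x"
  by (simp add: cs_def T_mult_left)

lemma T_eq_cs: "T s = cs s + hecke_scale (qhalf 1) (T 0)"
  by (simp add: cs_def)

lemma lookup_lmul:
  assumes s: "s \<in> S"
  shows "lookup (lmul s x) y = lookup x (s + y) + (if ldesc s y then xi * lookup x y else 0)"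
proof (induction x rule: poly_mapping_induct)
  case (single w c)
  have "s + y = w \<longleftrightarrow> y = s + w" using s by auto
  then have "lookup (lmul s (hecke_scale c (T w))) y =
      lookup (hecke_scale c (T w)) (s + y) + (if ldesc s y then xi * lookup (hecke_scale c (T w)) y else 0)"
    by (simp add: lmul_T lmul_linear lookup_add lookup_hecke_scale lookup_T ring_distribs)
  then show ?case by (simp add: hecke_scale_T)
qed (simp add: lmul_linear lookup_add ring_distribs)

lemma lookup_cs_mult:
  "s \<in> S \<Longrightarrow> lookup (cs s \<star> x) y =
     lookup x (s + y) - (if ldesc s y then qhalf (- 1) else qhalf 1) * lookup x y"
  by (simp add: cs_mult lookup_lmul lookup_minus lookup_hecke_scale xi_def ring_distribs)

text \<open>Chosen before existence is known, so that \<open>mu\<close> and \<open>mu_sum\<close>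
  can be used in the construction; \<open>KL_is_kl\<close> justifies the choice.\<close>

definition KL :: "'w \<Rightarrow> 'w hecke" where
  "KL w = (SOME C. is_kl w C)"

text \<open>
  Because of the signs in the definition of \<open>C\<^sub>w\<close>, this is the negative of the usual
  Kazhdan--Lusztig coefficient \<open>\<mu>(z, w)\<close>.
\<close>

definition mu :: "'w \<Rightarrow> 'w \<Rightarrow> complex" where
  "mu z w = lookup (lookup (KL w) z) 1"

definition mu_set :: "'w \<Rightarrow> 'w \<Rightarrow> 'w set" where
  "mu_set s w = {z. z \<noteq> w \<and> ldesc s z \<and> mu z w \<noteq> 0}"

lemma finite_mu_set [simp]: "finite (mu_set s w)"
  by (rule finite_subset[of _ "keys (KL w)"]) (auto simp: mu_set_def mu_def in_keys_iff)

definition mu_sum :: "'w \<Rightarrow> 'w \<Rightarrow> 'w hecke" where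
  "mu_sum s w = (\<Sum>z\<in>mu_set s w. hecke_scale (const (mu z w)) (KL z))"

text \<open>If \<open>s\<close> is a descent of \<open>y \<noteq> s + w\<close>, then
  \<open>cs s \<star> KL w\<close> has at \<open>y\<close> the term
  \<open>- qhalf (- 1) * lookup (KL w) y\<close>, with coefficient \<open>- mu y w\<close> at
  exponent 0. This is the only violation of positivity. Adding \<open>mu_sum\<close> cancels it,
  because \<open>KL y\<close> has coefficient 1 at \<open>y\<close> while the other summands have
  positive exponents there.\<close>

lemma kl_step:
  assumes s: "s \<in> S" and up: "\<not> ldesc s w"
    and kl: "\<And>z. len z \<le> len w \<Longrightarrow> is_kl z (KL z)"
  shows "is_kl (s + w) (cs s \<star> KL w + mu_sum s w)" (is "is_kl _ ?D")
proof -
  note C = kl[of w, simplified, unfolded is_kl_def]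
  have C_nz: "bruhat_le S y w" if "lookup (KL w) y \<noteq> 0" for y
    using C that by (cases "y = w") auto
  have mus: "bruhat_le S z w" "len z < len w" "is_kl z (KL z)" "mu z w \<in> \<int>"
      "odd (int (len w) - int (len z))" "ldesc s z" if "z \<in> mu_set s w" for z
  proof -
    have nz: "z \<noteq> w" "ldesc s z" "lookup (lookup (KL w) z) 1 \<noteq> 0"
      using that by (auto simp: mu_set_def mu_def)
    then show "bruhat_le S z w" by (intro C_nz) auto
    then show "len z < len w" using bruhat_le_len nz by blast
    then show "is_kl z (KL z)" by (intro kl) simp
    show "mu z w \<in> \<int>" "odd (int (len w) - int (len z))" "ldesc s z"
      using C nz by (auto simp: kl_coef_def mu_def)
  qed
  have lookup_D: "lookup ?D y = lookup (KL w) (s + y) -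
      (if ldesc s y then qhalf (- 1) else qhalf 1) * lookup (KL w) y +
      (\<Sum>z\<in>mu_set s w. const (mu z w) * lookup (KL z) y)" for y
    by (simp add: lookup_add lookup_cs_mult[OF s] mu_sum_def lookup_sum lookup_hecke_scale)
  have w_sw: "bruhat_le S w (s + w)"
    using bruhat_less_gen_iff[OF s, of w] up by (simp add: bruhat_less_def)
  have sw: "len (s + w) = Suc (len w)" by (rule not_ldesc_len[OF s up])
  have "bar ?D = ?D"
  proof -
    have "bar (mu_sum s w) = mu_sum s w"
      unfolding mu_sum_def bar_sum
      by (rule sum.cong) (use mus in \<open>auto simp: is_kl_def\<close>)
    then show ?thesis using C by (simp add: bar_mult bar_cs[OF s])
  qed
  moreover have "lookup ?D (s + w) = 1"
  proof -
    have "\<not> bruhat_le S (s + w) w"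
      using bruhat_le_len[of "s + w" w] sw by (metis lessI less_asym less_irrefl)
    then have "lookup (KL w) (s + w) = 0" using C_nz by blast
    moreover have "lookup (KL z) (s + w) = 0" if "z \<in> mu_set s w" for z
    proof (rule ccontr)
      assume "lookup (KL z) (s + w) \<noteq> 0"
      then have "s + w = z \<or> bruhat_le S (s + w) z" using mus(3)[OF that] by (auto simp: is_kl_def)
      then have "len (s + w) \<le> len z" using bruhat_le_len by fastforce
      then show False using mus(2)[OF that] sw by simp
    qed
    ultimately show ?thesis using C s by (simp add: lookup_D)
  qed
  moreover have "kl_coef (int (len (s + w)) - int (len y)) (lookup ?D y)" if y: "y \<noteq> s + w" for y
  proof -
    let ?d = "int (len w) + 1 - int (len y)"
    let ?c = "lookup (KL w) y"
    have "s + y \<noteq> w" using y s by auto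
    then have c1: "kl_coef (int (len w) - int (len (s + y))) (lookup (KL w) (s + y))"
      using C by blast
    have c0: "kl_coef (?d - 1) ?c" if "y \<noteq> w" using C that by simp
    have rest: "kl_coef ?d (\<Sum>z\<in>mu_set s w - {y}. const (mu z w) * lookup (KL z) y)"
    proof (intro kl_coef_sum kl_coef_const_mult)
      fix z assume z: "z \<in> mu_set s w - {y}"
      then show "mu z w \<in> \<int>" using mus by blast
      have "kl_coef (int (len z) - int (len y)) (lookup (KL z) y)"
        using mus(3)[of z] z by (auto simp: is_kl_def)
      then show "kl_coef ?d (lookup (KL z) y)"
        by (rule kl_coef_mono) (use mus(2,5)[of z] z in auto)
    qed
    have "kl_coef ?d (lookup ?D y)"
    proof (cases "ldesc s y")
      case True
      then have "y \<noteq> w" using up by blast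
      \<comment> \<open>The summand \<open>z = y\<close> supplies \<open>mu y w\<close>; outside
        \<open>mu_set\<close> this number is zero.\<close>
      have "(\<Sum>z\<in>mu_set s w. const (mu z w) * lookup (KL z) y) =
          const (mu y w) + (\<Sum>z\<in>mu_set s w - {y}. const (mu z w) * lookup (KL z) y)"
      proof (cases "y \<in> mu_set s w")
        case True
        then have "lookup (KL y) y = 1" using mus(3)[of y] by (simp add: is_kl_def)
        then show ?thesis using True by (simp add: sum.remove[of _ y])
      next
        case False
        then have "mu y w = 0" using True \<open>y \<noteq> w\<close> by (simp add: mu_set_def)
        then show ?thesis using False by simp
      qed
      then have D: "lookup ?D y = lookup (KL w) (s + y) + (const (mu y w) - qhalf (- 1) * ?c) +
          (\<Sum>z\<in>mu_set s w - {y}. const (mu z w) * lookup (KL z) y)"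
        using True by (simp add: lookup_D)
      have d: "int (len w) - int (len (s + y)) = ?d" using ldesc_len[OF s True] by simp
      have "kl_coef ?d (lookup (KL w) (s + y))" using c1 unfolding d .
      moreover have "kl_coef ?d (const (mu y w) - qhalf (- 1) * ?c)"
        unfolding kl_coef_def
      proof (intro allI)
        fix k
        have c: "lookup ?c (k + 1) \<in> \<int>"
            "lookup ?c (k + 1) \<noteq> 0 \<longrightarrow> 1 \<le> k + 1 \<and> k + 1 \<le> ?d - 1 \<and> even (?d - 1 - (k + 1))"
          using c0[OF \<open>y \<noteq> w\<close>] unfolding kl_coef_def by blast+
        \<comment> \<open>The constant cancels the term at exponent 0; every other exponent of
          \<open>?c\<close> drops by one.\<close>
        have l: "lookup (const (mu y w) - qhalf (- 1) * ?c) k = (if k = 0 then 0 else - lookup ?c (k + 1))"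
          by (simp add: lookup_minus lookup_single mu_def)
        show "lookup (const (mu y w) - qhalf (- 1) * ?c) k \<in> \<int> \<and>
          (lookup (const (mu y w) - qhalf (- 1) * ?c) k \<noteq> 0 \<longrightarrow> 1 \<le> k \<and> k \<le> ?d \<and> even (?d - k))"
          unfolding l using c by auto
      qed
      ultimately show ?thesis unfolding D by (intro kl_coef_add rest)
    next
      case False
      then have "y \<notin> mu_set s w" by (simp add: mu_set_def)
      then have D: "lookup ?D y = lookup (KL w) (s + y) + - (qhalf 1 * ?c) +
          (\<Sum>z\<in>mu_set s w - {y}. const (mu z w) * lookup (KL z) y)"
        using False by (simp add: lookup_D)
      \<comment> \<open>Here \<open>s + y\<close> is longer than \<open>y\<close>, so the bound from
        \<open>c1\<close> is \<open>?d - 2\<close>, which weakens to \<open>?d\<close> without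
        changing the parity.\<close>
      have "kl_coef ?d (lookup (KL w) (s + y))"
        by (rule kl_coef_mono[OF c1]) (use not_ldesc_len[OF s False] in auto)
      moreover have "kl_coef ?d (- (qhalf 1 * ?c))"
      proof (cases "y = w")
        case True
        then show ?thesis using C by (simp add: kl_coef_def lookup_qhalf)
      next
        case False
        then show ?thesis using kl_coef_shift[OF c0[OF False]]
          by (intro kl_coef_uminus) (simp add: algebra_simps)
      qed
      ultimately show ?thesis unfolding D by (intro kl_coef_add rest)
    qed
    then show ?thesis using sw by (simp add: algebra_simps)
  qed
  moreover have "bruhat_le S y (s + w)" if "lookup ?D y \<noteq> 0" for y
  proof -
    consider "lookup (KL w) (s + y) \<noteq> 0" | "lookup (KL w) y \<noteq> 0"
      | z where "z \<in> mu_set s w" "lookup (KL z) y \<noteq> 0"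
    proof -
      have "(\<Sum>z\<in>mu_set s w. const (mu z w) * lookup (KL z) y) = 0"
        if "\<And>z. z \<in> mu_set s w \<Longrightarrow> lookup (KL z) y = 0"
        using that by (intro sum.neutral) simp
      then show ?thesis using that \<open>lookup ?D y \<noteq> 0\<close> unfolding lookup_D by fastforce
    qed
    then show ?thesis
    proof cases
      case 1
      from bruhat_le_lift[OF s C_nz[OF 1] up] show ?thesis using s by simp
    next
      case 2
      from bruhat_le_trans[OF C_nz[OF 2] w_sw] show ?thesis .
    next
      case 3
      then have "bruhat_le S y z" using mus(3)[of z] by (cases "y = z") (auto simp: is_kl_def)
      then show ?thesis using mus(1)[OF 3(1)] w_sw bruhat_le_trans by blast
    qed
  qed
  ultimately show ?thesis unfolding is_kl_def by blast
qed

lemma KL_is_kl: "is_kl w (KL w)"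
proof (induction "len w" arbitrary: w rule: less_induct)
  case less
  have "\<exists>C. is_kl w C"
  proof (cases "w = 0")
    case True
    then have "is_kl w (T 0)" by (simp add: is_kl_def bar_T lookup_T)
    then show ?thesis by blast
  next
    case False
    then obtain s where s: "s \<in> S" "ldesc s w" using exists_ldesc by blast
    have "is_kl (s + (s + w)) (cs s \<star> KL (s + w) + mu_sum s (s + w))"
      by (rule kl_step) (use s less in auto)
    then show ?thesis using s by auto
  qed
  then show ?case unfolding KL_def by (rule someI_ex)
qed

lemma KL_eqI: "weak_kl w C \<Longrightarrow> KL w = C"
  using weak_kl_unique is_kl_imp_weak KL_is_kl by blast

lemma bar_KL [simp]: "bar (KL w) = KL w"
  and lookup_KL_self [simp]: "lookup (KL w) w = 1"
  and kl_coef_KL: "y \<noteq> w \<Longrightarrow> kl_coef (int (len w) - int (len y)) (lookup (KL w) y)"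
  using KL_is_kl[of w] by (auto simp: is_kl_def)

lemma KL_bruhat: "lookup (KL w) y \<noteq> 0 \<Longrightarrow> bruhat_le S y w"
  using KL_is_kl[of w] by (cases "y = w") (auto simp: is_kl_def)

lemma KL_len: "lookup (KL w) y \<noteq> 0 \<Longrightarrow> y = w \<or> len y < len w"
  using KL_bruhat bruhat_le_len by blast

lemma KL_0 [simp]: "KL 0 = T 0"
  by (rule KL_eqI) (simp add: weak_kl_def bar_T lookup_T)

lemma KL_up: "s \<in> S \<Longrightarrow> \<not> ldesc s w \<Longrightarrow> KL (s + w) = cs s \<star> KL w + mu_sum s w"
  by (rule KL_eqI[OF is_kl_imp_weak[OF kl_step]]) (simp_all add: KL_is_kl)

lemma mu_setD:
  assumes "z \<in> mu_set s w"
  shows "z \<noteq> w" "ldesc s z" "len z < len w" "mu z w \<noteq> 0" "mu z w \<in> \<int>"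
    and "lookup (KL w) z \<noteq> 0"
proof -
  show z: "z \<noteq> w" "ldesc s z" "mu z w \<noteq> 0" using assms by (auto simp: mu_set_def)
  then show "lookup (KL w) z \<noteq> 0" by (auto simp: mu_def)
  then show "len z < len w" using KL_len z by blast
  show "mu z w \<in> \<int>" using kl_coef_KL[OF z(1)] by (simp add: kl_coef_def mu_def)
qed

lemma KL_gen: "s \<in> S \<Longrightarrow> KL s = cs s"
proof -
  assume s: "s \<in> S"
  have "mu_sum s 0 = 0" using mu_setD(3)[of _ s 0] by (auto simp: mu_sum_def intro!: sum.neutral)
  then show ?thesis using KL_up[OF s, of 0] s by simp
qed

section \<open>Basis elements and their left descents\<close>

abbreviation v_sum :: laurent where "v_sum \<equiv> qhalf 1 + qhalf (- 1)"

lemma cs_square: assumes "s \<in> S" shows "cs s \<star> cs s = - hecke_scale v_sum (cs s)"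
proof -
  have "cs s \<star> cs s = hecke_scale xi (T s) + T 0 - hecke_scale (qhalf 1) (T s) -
      (hecke_scale (qhalf 1) (T s) - hecke_scale (qhalf 1 * qhalf 1) (T 0))"
    using T_square[OF assms] by (simp add: cs_def hecke.scale_right_diff_distrib)
  also have "\<dots> = - hecke_scale v_sum (cs s)"
    by (rule poly_mapping_eqI)
      (simp add: cs_def lookup_add lookup_minus lookup_hecke_scale xi_def algebra_simps qhalf_add)
  finally show ?thesis .
qed

text \<open>For \<open>w = s + u\<close>, \<open>KL w\<close> is \<open>cs s \<star> KL u\<close>
  plus basis elements of shorter \<open>z\<close> that again have the left descent \<open>s\<close>.
  The former is handled by \<open>cs_square\<close>, the latter by induction.\<close>

lemma cs_KL_down:
  assumes s: "s \<in> S" and "ldesc s w"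
  shows "cs s \<star> KL w = - hecke_scale v_sum (KL w)"
  using assms(2)
proof (induction "len w" arbitrary: w rule: less_induct)
  case less
  define u where "u = s + w"
  have w: "w = s + u" and u: "\<not> ldesc s u" and l: "len u < len w"
    using less.prems s by (auto simp: u_def)
  have "cs s \<star> mu_sum s u = - hecke_scale v_sum (mu_sum s u)"
    unfolding mu_sum_def hecke_mult_sum hecke.scale_sum_right sum_negf[symmetric]
  proof (rule sum.cong)
    fix z assume "z \<in> mu_set s u"
    then have "cs s \<star> KL z = - hecke_scale v_sum (KL z)"
      using less.hyps[of z] mu_setD[of z s u] l by simp
    then show "cs s \<star> hecke_scale (const (mu z u)) (KL z) =
        - hecke_scale v_sum (hecke_scale (const (mu z u)) (KL z))"
      by (simp add: mult.commute)
  qed simp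
  moreover have "cs s \<star> (cs s \<star> KL u) = - hecke_scale v_sum (cs s \<star> KL u)"
    unfolding hecke_assoc[symmetric] cs_square[OF s] by simp
  ultimately show ?case
    unfolding w KL_up[OF s u] by (simp add: hecke.scale_right_distrib)
qed

lemma T_KL_down:
  assumes "s \<in> S" "ldesc s w" shows "T s \<star> KL w = - hecke_scale (qhalf (- 1)) (KL w)"
  using cs_KL_down[OF assms] by (simp add: T_eq_cs[of s] hecke.scale_left_distrib)

text \<open>Coefficients at \<open>y\<close> in \<open>cs_KL_down\<close>. Along a left descent of
  \<open>w\<close> the coefficients thus differ by a unit, which yields \<open>mu_descent\<close>,
  \<open>KL_support_closed\<close> and the explicit dihedral coefficients.\<close>

lemma lookup_KL_down:
  assumes "s \<in> S" "ldesc s w" "\<not> ldesc s y"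
  shows "lookup (KL w) (s + y) = - qhalf (- 1) * lookup (KL w) y"
proof -
  have "lookup (cs s \<star> KL w) y = - (v_sum * lookup (KL w) y)"
    unfolding cs_KL_down[OF assms(1,2)] by (simp only: lookup_uminus lookup_hecke_scale)
  then show ?thesis using assms by (simp add: lookup_cs_mult algebra_simps eq_neg_iff_add_eq_0)
qed

text \<open>A nonzero coefficient of \<open>q^(1/2)\<close> at \<open>z\<close> becomes one of
  \<open>q^0\<close> at \<open>s + z\<close>, and only the leading coefficient, at \<open>w\<close>
  itself, has that exponent.\<close>

lemma mu_descent:
  assumes s: "s \<in> S" and w: "ldesc s w" and z: "\<not> ldesc s z" and mu: "mu z w \<noteq> 0"
  shows "w = s + z"
proof (rule ccontr)
  assume "w \<noteq> s + z"
  then have "lookup (lookup (KL w) (s + z)) 0 = 0"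
    using is_kl_imp_weak[OF KL_is_kl[of w]] by (auto simp: weak_kl_def)
  then show False using lookup_KL_down[OF s w z] mu by (simp add: mu_def)
qed

section \<open>The basis property and the Kazhdan--Lusztig polynomials\<close>

lemma inj_KL: "inj KL"
proof (rule injI)
  fix w w' assume "KL w = KL w'"
  then have "lookup (KL w) w' \<noteq> 0" "lookup (KL w') w \<noteq> 0"
    by (metis lookup_KL_self zero_neq_one)+
  then show "w = w'" using KL_len[of w w'] KL_len[of w' w] by auto
qed

lemma KL_independent: "hecke.independent (range KL)"
proof
  assume "hecke.dependent (range KL)"
  then obtain t u where t: "finite t" "t \<subseteq> range KL" and sum: "(\<Sum>v\<in>t. hecke_scale (u v) v) = 0"
    and nz: "\<exists>v\<in>t. u v \<noteq> 0"
    unfolding hecke.dependent_explicit by blast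
  define W where "W = {w. KL w \<in> t}"
  have tW: "t = KL ` W" using t by (auto simp: W_def)
  have finW: "finite W" using t(1) unfolding tW by (rule finite_imageD) (rule inj_on_subset[OF inj_KL subset_UNIV])
  let ?B = "{w \<in> W. u (KL w) \<noteq> 0}"
  have "?B \<noteq> {}" "finite ?B" using nz finW by (auto simp: tW)
  then obtain w where "w \<in> ?B" and "\<forall>z\<in>?B. len z \<le> len w"
    using exists_longest[of ?B] by blast
  then have w: "w \<in> W" "u (KL w) \<noteq> 0"
    and max: "\<And>z. z \<in> W \<Longrightarrow> u (KL z) \<noteq> 0 \<Longrightarrow> len z \<le> len w"
    by blast+
  have "0 = lookup (\<Sum>v\<in>t. hecke_scale (u v) v) w" unfolding sum by simp
  also have "\<dots> = (\<Sum>z\<in>W. u (KL z) * lookup (KL z) w)"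
    unfolding tW by (subst sum.reindex[OF inj_on_subset[OF inj_KL subset_UNIV]])
      (simp add: lookup_sum lookup_hecke_scale)
  also have "\<dots> = (\<Sum>z\<in>W. if z = w then u (KL w) else 0)"
  proof (rule sum.cong)
    fix z assume "z \<in> W"
    then show "u (KL z) * lookup (KL z) w = (if z = w then u (KL w) else 0)"
      using max[of z] KL_len[of z w] by (cases "u (KL z) = 0") auto
  qed simp
  also have "\<dots> = u (KL w)" using finW w by simp
  finally show False using w by simp
qed

lemma KL_span: "hecke.span (range KL) = UNIV"
proof -
  have T: "T w \<in> hecke.span (range KL)" for w
  proof (induction "len w" arbitrary: w rule: less_induct)
    case less
    let ?R = "\<Sum>y\<in>keys (KL w) - {w}. hecke_scale (lookup (KL w) y) (T y)"
    have "KL w = (\<Sum>y\<in>keys (KL w). hecke_scale (lookup (KL w) y) (T y))"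
      by (rule hecke_expand)
    also have "\<dots> = T w + ?R"
      by (subst sum.remove[of _ w]) (simp_all add: in_keys_iff)
    finally have "T w = KL w - ?R" by (simp add: algebra_simps)
    moreover have "?R \<in> hecke.span (range KL)"
      using less KL_len by (intro hecke.span_sum hecke.span_scale) (auto simp: in_keys_iff)
    ultimately show ?case using hecke.span_diff hecke.span_base[of "KL w" "range KL"] by auto
  qed
  have "x \<in> hecke.span (range KL)" for x
    by (subst hecke_expand) (intro hecke.span_sum hecke.span_scale T)
  then show ?thesis by blast
qed

text \<open>The power \<open>q^i\<close> in \<open>P\<close> corresponds to the exponent
  \<open>len w - len y - 2 * i\<close> in \<open>KL w\<close>. Floor and real part only move complex
  numbers that are integers by \<open>KL_coef_int\<close> into type \<open>int\<close>.\<close>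

definition klP :: "'w \<Rightarrow> 'w \<Rightarrow> int poly" where
  "klP y w = (\<Sum>i\<le>len w. monom ((- 1) ^ (len w + len y) *
     \<lfloor>Re (lookup (lookup (KL w) y) (int (len w) - int (len y) - 2 * int i))\<rfloor>) i)"

lemma KL_coef_int: "lookup (lookup (KL w) y) k \<in> \<int>"
  using kl_coef_KL[of y w] by (cases "y = w") (auto simp: kl_coef_def lookup_one when_def)

lemma KL_coef_bounds:
  assumes "lookup (lookup (KL w) y) k \<noteq> 0"
  shows "0 \<le> k" "k \<le> int (len w) - int (len y)" "even (int (len w) - int (len y) - k)" "y \<noteq> w \<Longrightarrow> 1 \<le> k"
proof -
  have "0 \<le> k \<and> k \<le> int (len w) - int (len y) \<and> even (int (len w) - int (len y) - k) \<and>
      (y \<noteq> w \<longrightarrow> 1 \<le> k)"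
  proof (cases "y = w")
    case True
    then have "k = 0" using assms by (simp add: lookup_one when_def split: if_splits)
    then show ?thesis using True by simp
  next
    case False
    then have "1 \<le> k \<and> k \<le> int (len w) - int (len y) \<and> even (int (len w) - int (len y) - k)"
      using assms kl_coef_KL[OF False] unfolding kl_coef_def by blast
    then show ?thesis by linarith
  qed
  then show "0 \<le> k" "k \<le> int (len w) - int (len y)" "even (int (len w) - int (len y) - k)"
    "y \<noteq> w \<Longrightarrow> 1 \<le> k" by blast+
qed

lemma coeff_klP:
  "coeff (klP y w) i = (- 1) ^ (len w + len y) *
     \<lfloor>Re (lookup (lookup (KL w) y) (int (len w) - int (len y) - 2 * int i))\<rfloor>"
proof (cases "i \<le> len w")
  case True
  then show ?thesis by (simp add: klP_def coeff_sum)
next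
  case False
  then have "lookup (lookup (KL w) y) (int (len w) - int (len y) - 2 * int i) = 0"
    using KL_coef_bounds(1)[of w y "int (len w) - int (len y) - 2 * int i"] by auto
  then show ?thesis using False by (simp add: klP_def coeff_sum)
qed

lemma of_int_floor_Re: "z \<in> \<int> \<Longrightarrow> of_int \<lfloor>Re z\<rfloor> = z"
  by (elim Ints_cases) simp

lemma lookup_kl_form:
  "lookup ((- 1) ^ n * qhalf d * laurent_bar (int_poly_at p (qhalf 2))) k =
    (- 1) ^ n * (if even (d - k) \<and> k \<le> d then of_int (coeff p (nat ((d - k) div 2))) else 0)"
  by (simp add: mult.assoc lookup_sign_mult lookup_laurent_bar lookup_int_poly_at)

lemma KL_klP:
  "lookup (KL w) y = (- 1) ^ (len w + len y) * qhalf (int (len w) - int (len y)) *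
    laurent_bar (int_poly_at (klP y w) (qhalf 2))"
proof (rule poly_mapping_eqI)
  fix k
  let ?d = "int (len w) - int (len y)"
  show "lookup (lookup (KL w) y) k = lookup ((- 1) ^ (len w + len y) * qhalf ?d *
      laurent_bar (int_poly_at (klP y w) (qhalf 2))) k"
  proof (cases "even (?d - k) \<and> k \<le> ?d")
    case True
    then have "?d - 2 * int (nat ((?d - k) div 2)) = k" by (auto elim: evenE)
    then have "lookup (lookup (KL w) y) k = of_int \<lfloor>Re (lookup (lookup (KL w) y) (?d - 2 * int (nat ((?d - k) div 2))))\<rfloor>"
      using of_int_floor_Re[OF KL_coef_int] by metis
    then show ?thesis using True unfolding lookup_kl_form coeff_klP
      by (simp flip: mult.assoc power_add)
  next
    case False
    then show ?thesis using KL_coef_bounds[of w y k] unfolding lookup_kl_form by auto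
  qed
qed

lemma is_kl_basis_KL: "is_kl_basis S KL"
  unfolding is_kl_basis_def
proof (intro conjI exI[of _ klP] allI impI)
  show "inj KL" "hecke.independent (range KL)" "hecke.span (range KL) = UNIV"
    by (rule inj_KL KL_independent KL_span)+
  show "lookup (KL w) y = (- 1) ^ (len w + len y) * qhalf (int (len w) - int (len y)) *
    laurent_bar (int_poly_at (klP y w) (qhalf 2))" for y w
    by (rule KL_klP)
  show "hecke_bar S (KL w) = KL w" for w by (simp add: hecke_bar_eq)
  show "klP y w = 0" if "\<not> bruhat_le S y w" for y w
  proof (rule poly_eqI)
    have "lookup (KL w) y = 0" using that KL_bruhat by blast
    then show "coeff (klP y w) i = coeff 0 i" for i by (simp add: coeff_klP)
  qed
  show "klP w w = 1" for w
    by (rule poly_eqI) (auto simp: coeff_klP lookup_one when_def coeff_1 simp flip: power_add mult_2)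
  show "real (degree (klP y w)) \<le> (real (len w) - real (len y) - 1) / 2"
    if "bruhat_less S y w" for y w
  proof (cases "klP y w = 0")
    case True
    then show ?thesis using that bruhat_le_len[of y w] by (auto simp: bruhat_less_def)
  next
    case False
    then have "coeff (klP y w) (degree (klP y w)) \<noteq> 0" by simp
    then have "lookup (lookup (KL w) y) (int (len w) - int (len y) - 2 * int (degree (klP y w))) \<noteq> 0"
      by (auto simp: coeff_klP)
    then have "1 \<le> int (len w) - int (len y) - 2 * int (degree (klP y w))"
      using KL_coef_bounds(4) that by (auto simp: bruhat_less_def)
    then have "int (2 * degree (klP y w) + 1 + len y) \<le> int (len w)" by simp
    then have "real (2 * degree (klP y w) + 1 + len y) \<le> real (len w)" by linarith
    then show ?thesis by simp
  qed
qed

lemma is_kl_basis_unique: "is_kl_basis S C \<Longrightarrow> C = KL"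
proof
  fix w
  assume "is_kl_basis S C"
  then obtain P :: "'w \<Rightarrow> 'w \<Rightarrow> int poly" where
    C: "\<And>y w. lookup (C w) y = (- 1) ^ (len w + len y) * qhalf (int (len w) - int (len y)) *
      laurent_bar (int_poly_at (P y w) (qhalf 2))"
    and bar: "\<And>w. bar (C w) = C w" and P0: "\<And>y w. \<not> bruhat_le S y w \<Longrightarrow> P y w = 0"
    and P1: "\<And>w. P w w = 1"
    and deg: "\<And>y w. bruhat_less S y w \<Longrightarrow>
      real (degree (P y w)) \<le> (real (len w) - real (len y) - 1) / 2"
    unfolding is_kl_basis_def hecke_bar_eq by blast
  have "weak_kl w (C w)" unfolding weak_kl_def
  proof (intro conjI allI impI)
    show "bar (C w) = C w" by (rule bar)
    show "lookup (C w) w = 1" by (simp add: C P1 flip: mult_2)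
    show "lookup (lookup (C w) y) k = 0" if "y \<noteq> w" "k \<le> 0" for y k
    proof (cases "bruhat_le S y w")
      case True
      let ?i = "nat ((int (len w) - int (len y) - k) div 2)"
      have "real (degree (P y w)) \<le> (real (len w) - real (len y) - 1) / 2"
        by (rule deg) (simp add: True that bruhat_less_def)
      then have "real (2 * degree (P y w) + 1 + len y) \<le> real (len w)" by simp
      then have "2 * degree (P y w) + 1 + len y \<le> len w" by linarith
      \<comment> \<open>Since \<open>k \<le> 0\<close>, the index \<open>?i\<close> is at least half
        the length difference, beyond the degree bound.\<close>
      moreover have "coeff (P y w) ?i = 0" if "even (int (len w) - int (len y) - k)"
      proof -
        from that obtain m where m: "int (len w) - int (len y) - k = 2 * m" by (elim evenE)
        then have "?i = nat m" by simp
        with calculation m \<open>k \<le> 0\<close> show ?thesis by (intro coeff_eq_0) linarith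
      qed
      ultimately show ?thesis unfolding C lookup_kl_form by simp
    next
      case False
      then show ?thesis unfolding C by (simp add: P0)
    qed
  qed
  then show "C w = KL w" using KL_eqI by simp
qed

lemma kl_C_eq: "kl_C S = KL"
  unfolding kl_C_def by (rule the_equality) (fact is_kl_basis_KL, erule is_kl_basis_unique)

section \<open>Elements with several reduced words\<close>

text \<open>The branching elements of the overview. Words count literally, so the product of two
  distinct commuting generators is branching.\<close>

definition multi_red :: "'w \<Rightarrow> bool" where
  "multi_red w \<longleftrightarrow> (\<exists>u v. red u \<and> red v \<and> u \<noteq> v \<and> sum_list u = w \<and> sum_list v = w)"

lemma exists_red_Cons:
  assumes "s \<in> S" "ldesc s w"
  shows "\<exists>u. red (s # u) \<and> sum_list (s # u) = w"
proof -
  have "red (s # red_word (s + w))"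
    using assms ldesc_gen_self[of s "s + w"] by (intro red_Cons) (simp_all add: red_word)
  then show ?thesis using assms by (intro exI[of _ "red_word (s + w)"]) (simp add: red_word)
qed

lemma multi_red_two_ldesc:
  assumes "r \<in> S" "t \<in> S" "r \<noteq> t" "ldesc r w" "ldesc t w"
  shows "multi_red w"
proof -
  obtain u v where "red (r # u)" "sum_list (r # u) = w" "red (t # v)" "sum_list (t # v) = w"
    using exists_red_Cons assms by metis
  moreover have "r # u \<noteq> t # v" using assms(3) by simp
  ultimately show ?thesis unfolding multi_red_def by blast
qed

lemma multi_red_up:
  assumes "s \<in> S" "\<not> ldesc s w" "multi_red w" shows "multi_red (s + w)"
proof -
  obtain u v where "red u" "red v" "u \<noteq> v" "sum_list u = w" "sum_list v = w"
    using assms(3) unfolding multi_red_def by blast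
  then show ?thesis unfolding multi_red_def using assms
    by (intro exI[of _ "s # u"] exI[of _ "s # v"]) (auto intro: red_Cons)
qed

lemma multi_red_nonzero: assumes "multi_red w" shows "w \<noteq> 0"
proof -
  obtain u v where uv: "red u" "red v" "u \<noteq> v" "sum_list u = w" "sum_list v = w"
    using assms unfolding multi_red_def by blast
  then have "length u = len w" "length v = len w" by (auto simp: red_def)
  with uv(3) show ?thesis by auto
qed

text \<open>All reduced words of \<open>w\<close> start with \<open>r\<close>, so deleting the first
  letter keeps distinct words distinct.\<close>

lemma multi_red_down:
  assumes "multi_red w" and "\<And>s. s \<in> S \<Longrightarrow> ldesc s w \<Longrightarrow> s = r"
  shows "multi_red (r + w)"
proof -
  obtain u v where uv: "red u" "red v" "u \<noteq> v" "sum_list u = w" "sum_list v = w"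
    using assms(1) unfolding multi_red_def by blast
  have Cons: "\<exists>u'. u = r # u' \<and> red u' \<and> sum_list u' = r + w" if u: "red u" "sum_list u = w" for u
  proof (cases u)
    case Nil
    then show ?thesis using u multi_red_nonzero[OF assms(1)] by simp
  next
    case (Cons a u')
    note red_ConsD[OF u(1)[unfolded Cons]]
    moreover from this have "a = r" using assms(2) u Cons by auto
    ultimately show ?thesis using Cons u by auto
  qed
  from Cons[OF uv(1,4)] Cons[OF uv(2,5)] uv(3) show ?thesis
    unfolding multi_red_def by auto
qed

lemma multi_red_uminus [simp]: "multi_red (- w) \<longleftrightarrow> multi_red w"
proof -
  have "multi_red (- w)" if w: "multi_red w" for w
  proof -
    obtain u v where "red u" "red v" "u \<noteq> v" "sum_list u = w" "sum_list v = w"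
      using w unfolding multi_red_def by blast
    then have "red (rev u)" "red (rev v)" "rev u \<noteq> rev v" "sum_list (rev u) = - w" "sum_list (rev v) = - w"
      using red_rev by auto
    then show ?thesis unfolding multi_red_def by blast
  qed
  from this[of w] this[of "- w"] show ?thesis by auto
qed

lemma mu_multi_red:
  assumes s: "s \<in> S" and up: "\<not> ldesc s w" and w: "multi_red w" and z: "z \<in> mu_set s w"
  shows "multi_red z"
proof (rule ccontr)
  assume nz: "\<not> multi_red z"
  \<comment> \<open>A non-branching \<open>z\<close> has no left descent besides \<open>s\<close>,
    and \<open>s\<close> is not one of \<open>w\<close>; so \<open>mu_descent\<close> applies to
    each left descent \<open>r\<close> of \<open>w\<close>.\<close>
  have w_eq: "w = r + z" if r: "r \<in> S" "ldesc r w" for r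
  proof (rule mu_descent[OF r])
    show "mu z w \<noteq> 0" using mu_setD[OF z] by simp
    show "\<not> ldesc r z"
      using multi_red_two_ldesc[OF r(1) s, of z] mu_setD(2)[OF z] nz up r(2) by blast
  qed
  obtain r where r: "r \<in> S" "ldesc r w" using exists_ldesc[OF multi_red_nonzero[OF w]] by blast
  have "s' = r" if "s' \<in> S" "ldesc s' w" for s'
    using w_eq[OF that] w_eq[OF r] by simp
  from multi_red_down[OF w this] have "multi_red (r + w)" .
  then show False using w_eq[OF r] r nz by simp
qed

section \<open>The anti-involution and right multiplication\<close>

text \<open>It reverses products, commutes with \<open>bar\<close> and sends \<open>KL w\<close> to
  \<open>KL (- w)\<close>, so that formulas for right multiplication are mirror images of those for
  left multiplication.\<close>

definition tau :: "'w hecke \<Rightarrow> 'w hecke" where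
  "tau = lext (\<lambda>w. T (- w))"

lemma tau_hom: "hecke_hom tau"
  unfolding tau_def by (rule lext_hom)

lemma tau_simps [simp]: "tau (x + y) = tau x + tau y" "tau (hecke_scale c x) = hecke_scale c (tau x)"
  "tau (T w) = T (- w)"
  using tau_hom by (simp_all add: hecke_hom_iff) (simp add: tau_def)

lemma lookup_tau: "lookup (tau x) y = lookup x (- y)"
proof (induction x rule: poly_mapping_induct)
  case (single w c)
  have "lookup (tau (hecke_scale c (T w))) y = lookup (hecke_scale c (T w)) (- y)"
    by (auto simp: lookup_hecke_scale lookup_T)
  then show ?case by (simp add: hecke_scale_T)
qed (simp add: lookup_add)

lemma tau_tau [simp]: "tau (tau x) = x"
  by (rule poly_mapping_eqI) (simp add: lookup_tau)

lemma rdesc_iff: "s \<in> S \<Longrightarrow> rdesc s w \<longleftrightarrow> ldesc s (- w)"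
  by (simp add: len_gen_right)

lemma tau_lmul: assumes s: "s \<in> S" shows "tau (lmul s x) = rmul s (tau x)"
proof (rule hecke_hom_eqI[OF hecke_hom_comp[OF tau_hom lmul_hom] hecke_hom_comp[OF rmul_hom tau_hom]])
  fix w
  show "tau (lmul s (T w)) = rmul s (tau (T w))"
    using s rdesc_iff[OF s, of "- w"] by (simp add: lmul_T rmul_T minus_add module_hom.zero[OF tau_hom] del: add_uminus_conv_diff)
qed

lemma tau_mult: "tau (x \<star> y) = tau y \<star> tau x"
proof (rule hecke_hom_eqI[OF hecke_hom_comp[OF tau_hom hecke_hom_left] hecke_hom_comp[OF hecke_hom_right tau_hom]])
  show "tau (T w \<star> y) = tau y \<star> tau (T w)" for w
  proof (induction w rule: len_induct)
    case (gen s w)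
    have "tau (T (s + w) \<star> y) = tau (T s \<star> (T w \<star> y))"
      using gen(1,2) by (simp add: T_add hecke_assoc)
    also have "\<dots> = tau (T w \<star> y) \<star> T s"
      unfolding T_mult_left[OF gen(1)] T_mult_right[OF gen(1)] by (rule tau_lmul[OF gen(1)])
    finally have "tau (T (s + w) \<star> y) = tau (T w \<star> y) \<star> T s" .
    then show ?case using gen T_minus_gen[OF gen(1,2)] by (simp add: hecke_assoc)
  qed simp
qed

lemma tau_bar: "bar (tau x) = tau (bar x)"
proof (rule hecke_additive_eqI[where f = "\<lambda>x. bar (tau x)" and g = "\<lambda>x. tau (bar x)"])
  fix c w
  have "is_inv (tau (T_bar w)) (T w)"
    using T_bar_is_inv[of w] tau_mult[of "T_bar w" "T (- w)", symmetric]
      tau_mult[of "T (- w)" "T_bar w", symmetric]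
    unfolding is_inv_def by simp
  then have "T_bar (- w) = tau (T_bar w)" by (intro T_bar_eqI) simp
  then show "bar (tau (hecke_scale c (T w))) = tau (bar (hecke_scale c (T w)))"
    by (simp add: bar_T)
qed simp_all

lemma tau_KL: "tau (KL w) = KL (- w)"
proof -
  have "weak_kl (- w) (tau (KL w))"
    using is_kl_imp_weak[OF KL_is_kl[of w]] by (auto simp: weak_kl_def lookup_tau tau_bar) (metis minus_minus)
  then show ?thesis using KL_eqI by simp
qed

lemma tau_cs: "s \<in> S \<Longrightarrow> tau (cs s) = cs s"
  using tau_KL[of s] by (simp add: KL_gen)

lemma KL_cs_down: "s \<in> S \<Longrightarrow> rdesc s w \<Longrightarrow> KL w \<star> cs s = - hecke_scale v_sum (KL w)"
  using tau_mult[of "cs s" "KL (- w)"] cs_KL_down[of s "- w"] module_hom.neg[OF tau_hom]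
  by (simp add: tau_cs tau_KL rdesc_iff)

lemma KL_cs_up:
  assumes "s \<in> S" "\<not> rdesc s w"
  shows "KL w \<star> cs s = KL (w + s) - (\<Sum>z\<in>mu_set s (- w). hecke_scale (const (mu z (- w))) (KL (- z)))"
proof -
  have "tau (KL (s + - w)) = tau (cs s \<star> KL (- w)) + tau (mu_sum s (- w))"
    using assms KL_up[of s "- w"] by (simp add: rdesc_iff del: add_uminus_conv_diff)
  moreover have "- (s + - w) = w + s" using assms by (simp add: minus_add)
  ultimately have "KL (w + s) = KL w \<star> cs s + tau (mu_sum s (- w))"
    using assms by (simp add: tau_mult tau_KL tau_cs)
  then show ?thesis by (simp add: mu_sum_def module_hom.sum[OF tau_hom] tau_KL)
qed

section \<open>Structure constants\<close>

definition co :: "'w \<Rightarrow> 'w hecke \<Rightarrow> laurent" where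
  "co w x = hecke.representation (range KL) x (KL w)"

lemma in_KL_span: "x \<in> hecke.span (range KL)"
  by (simp add: KL_span)

lemma co_add [simp]: "co w (x + y) = co w x + co w y"
  and co_scale [simp]: "co w (hecke_scale c x) = c * co w x"
  unfolding co_def
  by (simp_all add: hecke.representation_add[OF KL_independent in_KL_span in_KL_span]
      hecke.representation_scale[OF KL_independent in_KL_span])

lemma co_KL: "co w (KL z) = (if w = z then 1 else 0)"
  unfolding co_def using inj_KL
  by (subst hecke.representation_basis[OF KL_independent]) (auto dest: injD)

lemma co_additive: "additive (co w)"
  by (simp add: additive_def)

lemmas co_zero [simp] = additive.zero[OF co_additive]

lemma KL_expand: "\<exists>A. finite A \<and> (\<forall>w. co w x \<noteq> 0 \<longleftrightarrow> w \<in> A) \<and> x = (\<Sum>w\<in>A. hecke_scale (co w x) (KL w))"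
proof (intro exI conjI allI)
  let ?A = "{w. co w x \<noteq> 0}"
  let ?R = "{b. hecke.representation (range KL) x b \<noteq> 0}"
  have R: "?R = KL ` ?A" using hecke.representation_ne_zero[of "range KL" x] by (auto simp: co_def)
  have inj: "inj_on KL ?A" by (rule inj_on_subset[OF inj_KL subset_UNIV])
  show "finite ?A"
    using hecke.finite_representation[of "range KL" x] unfolding R by (rule finite_imageD) (rule inj)
  have "x = (\<Sum>b\<in>?R. hecke_scale (hecke.representation (range KL) x b) b)"
    by (rule hecke.sum_nonzero_representation_eq[OF KL_independent in_KL_span, symmetric])
  also have "\<dots> = (\<Sum>w\<in>?A. hecke_scale (co w x) (KL w))"
    unfolding R by (subst sum.reindex[OF inj]) (simp add: co_def)
  finally show "x = (\<Sum>w\<in>?A. hecke_scale (co w x) (KL w))" .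
qed simp

lemma co_tau: "co w (tau x) = co (- w) x"
proof -
  obtain A where "finite A" and x: "x = (\<Sum>w\<in>A. hecke_scale (co w x) (KL w))"
    using KL_expand by blast
  define c where "c = (\<lambda>w. co w x)"
  have x: "x = (\<Sum>w\<in>A. hecke_scale (c w) (KL w))" using x by (simp add: c_def)
  have "co w (tau x) = (\<Sum>z\<in>A. c z * co w (KL (- z)))"
    by (subst x) (simp add: module_hom.sum[OF tau_hom] additive.sum[OF co_additive] tau_KL)
  also have "\<dots> = (\<Sum>z\<in>A. c z * co (- w) (KL z))"
    by (rule sum.cong) (auto simp: co_KL)
  also have "\<dots> = co (- w) x"
    by (subst x) (simp add: additive.sum[OF co_additive])
  finally show ?thesis .
qed

text \<open>For \<open>d = 0\<close> this is the two-sided ideal spanned by the \<open>C\<^sub>w\<close> with several reduced words for \<open>w\<close>.\<close>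

definition int_mult :: "laurent \<Rightarrow> 'w hecke set" where
  "int_mult d = {x. \<forall>w. \<not> multi_red w \<longrightarrow> (\<exists>n::int. co w x = d * of_int n)}"

lemma int_mult_add: "x \<in> int_mult d \<Longrightarrow> y \<in> int_mult d \<Longrightarrow> x + y \<in> int_mult d"
  unfolding int_mult_def by (clarsimp) (metis of_int_add distrib_left)

lemma int_mult_of_int: "x \<in> int_mult d \<Longrightarrow> hecke_scale (of_int n) x \<in> int_mult d"
  unfolding int_mult_def by (clarsimp) (metis of_int_mult mult.left_commute)

lemma int_mult_const: "x \<in> int_mult d \<Longrightarrow> a \<in> \<int> \<Longrightarrow> hecke_scale (const a) x \<in> int_mult d"
  using int_mult_of_int by (auto elim!: Ints_cases)

lemma int_mult_uminus: "x \<in> int_mult d \<Longrightarrow> - x \<in> int_mult d"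
  using int_mult_of_int[of x d "- 1"] by simp

lemma int_mult_diff: "x \<in> int_mult d \<Longrightarrow> y \<in> int_mult d \<Longrightarrow> x - y \<in> int_mult d"
  using int_mult_add[OF _ int_mult_uminus] by fastforce

lemma int_mult_zero [simp]: "0 \<in> int_mult d"
  by (auto simp: int_mult_def intro: exI[of _ 0])

lemma int_mult_sum: "(\<And>z. z \<in> A \<Longrightarrow> f z \<in> int_mult d) \<Longrightarrow> sum f A \<in> int_mult d"
  by (induction A rule: infinite_finite_induct) (auto intro: int_mult_add)

lemma int_mult_0_scale: "x \<in> int_mult 0 \<Longrightarrow> hecke_scale c x \<in> int_mult 0"
  by (auto simp: int_mult_def)

lemma int_mult_0_subset: "x \<in> int_mult 0 \<Longrightarrow> x \<in> int_mult d"
  by (auto simp: int_mult_def intro: exI[of _ 0])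

lemma int_mult_scale: "x \<in> int_mult 1 \<Longrightarrow> hecke_scale c x \<in> int_mult c"
  by (auto simp: int_mult_def)

lemma KL_int_mult: "KL w \<in> int_mult 1"
proof -
  have "co z (KL w) = 1 * of_int (if z = w then 1 else 0)" for z by (simp add: co_KL)
  then show ?thesis unfolding int_mult_def by blast
qed

lemma KL_multi_red: "multi_red w \<Longrightarrow> KL w \<in> int_mult 0"
  by (auto simp: int_mult_def co_KL)

lemma int_mult_0_expand:
  assumes "x \<in> int_mult 0" "hecke_hom f" "\<And>w. multi_red w \<Longrightarrow> f (KL w) \<in> int_mult 0"
  shows "f x \<in> int_mult 0"
proof -
  obtain A where A: "finite A" "\<forall>w. co w x \<noteq> 0 \<longleftrightarrow> w \<in> A"
    and x: "x = (\<Sum>w\<in>A. hecke_scale (co w x) (KL w))"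
    using KL_expand by blast
  have "f x = (\<Sum>w\<in>A. hecke_scale (co w x) (f (KL w)))"
    by (subst x) (simp add: module_hom.sum[OF assms(2)] module_hom.scale[OF assms(2)])
  moreover have "multi_red w" if "w \<in> A" for w
    using assms(1) A(2) that by (auto simp: int_mult_def)
  ultimately show ?thesis using assms(3) by (auto intro!: int_mult_sum int_mult_0_scale)
qed

text \<open>At a descent the product is a multiple of \<open>KL w\<close>. Otherwise its terms are
  \<open>KL (s + w)\<close>, branching by \<open>multi_red_up\<close>, and the \<open>KL z\<close>
  covered by \<open>mu_multi_red\<close>.\<close>

lemma cs_KL_multi_red:
  assumes s: "s \<in> S" and w: "multi_red w" shows "cs s \<star> KL w \<in> int_mult 0"
proof (cases "ldesc s w")
  case True
  then show ?thesis using cs_KL_down[OF s] KL_multi_red[OF w] int_mult_uminus int_mult_0_scale by simp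
next
  case False
  have "mu_sum s w \<in> int_mult 0" unfolding mu_sum_def
    by (intro int_mult_sum int_mult_0_scale KL_multi_red mu_multi_red[OF s False w])
  moreover have "KL (s + w) \<in> int_mult 0" using multi_red_up[OF s False w] by (rule KL_multi_red)
  ultimately have "KL (s + w) - mu_sum s w \<in> int_mult 0" by (rule int_mult_diff[rotated])
  then show ?thesis using KL_up[OF s False] by simp
qed

lemma int_mult_0_left: assumes "x \<in> int_mult 0" shows "y \<star> x \<in> int_mult 0"
proof -
  have gen: "T s \<star> x \<in> int_mult 0" if "s \<in> S" "x \<in> int_mult 0" for s x
  proof -
    have "cs s \<star> x \<in> int_mult 0"
      by (rule int_mult_0_expand[OF that(2) hecke_hom_right]) (rule cs_KL_multi_red[OF that(1)])
    then show ?thesis using that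
      by (simp add: T_eq_cs[of s] int_mult_add int_mult_0_scale)
  qed
  have T: "T w \<star> x \<in> int_mult 0" for w
  proof (induction w rule: len_induct)
    case (gen s w)
    then show ?case using \<open>\<And>x s. s \<in> S \<Longrightarrow> x \<in> int_mult 0 \<Longrightarrow> T s \<star> x \<in> int_mult 0\<close>
      by (simp add: T_add hecke_assoc)
  qed (simp add: assms)
  have "y \<star> x = (\<Sum>w\<in>keys y. hecke_scale (lookup y w) (T w \<star> x))"
    by (subst hecke_expand[of y]) (simp add: hecke_mult_sum)
  then show ?thesis by (simp add: int_mult_sum int_mult_0_scale T)
qed

lemma int_mult_tau: "x \<in> int_mult d \<Longrightarrow> tau x \<in> int_mult d"
  by (simp add: int_mult_def co_tau)

lemma int_mult_0_right: assumes "x \<in> int_mult 0" shows "x \<star> y \<in> int_mult 0"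
  using int_mult_tau[OF int_mult_0_left[OF int_mult_tau[OF assms], of "tau y"]]
  by (simp add: tau_mult)

text \<open>
  The induction strips the first letter \<open>t\<close> from \<open>y = t y'\<close>. A factor \<open>q\<^sup>1\<^sup>/\<^sup>2 + q\<^sup>-\<^sup>1\<^sup>/\<^sup>2\<close> arises only from
  \<open>C\<^sub>x C\<^sub>t\<close> with \<open>s = t\<close>, and no second one can follow, because \<open>y'\<close> does not start with \<open>t\<close>.
\<close>

lemma KL_mult_int_mult:
  assumes "s \<in> S" "t \<in> S" "rdesc s x" "ldesc t y" "\<not> multi_red x" "\<not> multi_red y"
  shows "KL x \<star> KL y \<in> int_mult (if s = t then v_sum else 1)"
  using assms
proof (induction "len y" arbitrary: x y s t rule: less_induct)
  case less
  note s = less.prems(1) and t = less.prems(2)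
  define d where "d = (if s = t then v_sum else 1)"
  define y' where "y' = t + y"
  have y: "y = t + y'" and up: "\<not> ldesc t y'" and l: "len y' < len y"
    using less.prems t by (auto simp: y'_def)
  have y'_multi: "\<not> multi_red y'" using multi_red_up[OF t up] less.prems y by auto
  have mu: "KL x \<star> mu_sum t y' \<in> int_mult d"
    unfolding mu_sum_def hecke_mult_sum
  proof (intro int_mult_sum)
    \<comment> \<open>\<open>z\<close> is shorter than \<open>y\<close> and also has the left
      descent \<open>t\<close>, so induction gives the same \<open>d\<close>; a branching
      \<open>z\<close> falls into the ideal.\<close>
    fix z assume z: "z \<in> mu_set t y'"
    note mu_setD[OF z]
    then have "KL x \<star> KL z \<in> int_mult d"
      using less.hyps[of z s t x] less.prems l int_mult_0_subset[OF int_mult_0_left[OF KL_multi_red]]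
      unfolding d_def by (cases "multi_red z") simp_all
    then show "KL x \<star> hecke_scale (const (mu z y')) (KL z) \<in> int_mult d"
      using int_mult_const mu_setD(5)[OF z] by simp
  qed
  \<comment> \<open>\<open>p\<close> ends in a letter with which \<open>y'\<close> does not start,
    so induction yields the case of distinct letters, without a factor \<open>v_sum\<close>.\<close>
  have ends: "KL p \<star> KL y' \<in> int_mult 1" if p: "r \<in> S" "rdesc r p" "r = t \<or> \<not> ldesc r y'" for p r
  proof (cases "y' = 0 \<or> multi_red p")
    case True
    then show ?thesis
      using KL_int_mult int_mult_0_subset[OF int_mult_0_right[OF KL_multi_red]] by auto
  next
    case False
    then obtain t' where t': "t' \<in> S" "ldesc t' y'" using exists_ldesc by blast
    then have "r \<noteq> t'" using up p by blast
    with less.hyps[OF l p(1) t'(1) p(2) t'(2)] False y'_multi show ?thesis by simp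
  qed
  have main: "(KL x \<star> cs t) \<star> KL y' \<in> int_mult d"
  proof (cases "s = t")
    case True
    have "hecke_scale v_sum (KL x \<star> KL y') \<in> int_mult v_sum"
      using less.prems True by (intro int_mult_scale ends[of t]) auto
    then show ?thesis using less.prems True KL_cs_down[OF t, of x]
      by (simp add: d_def int_mult_uminus)
  next
    case False
    have "\<not> rdesc t x"
      using multi_red_two_ldesc[OF s t False, of "- x"] less.prems by (auto simp: rdesc_iff)
    note up' = KL_cs_up[OF t this] and r = rdesc_gen_self[OF t, of x]
    have "KL (x + t) \<star> KL y' \<in> int_mult 1"
      using t \<open>\<not> rdesc t x\<close> r by (intro ends[of t]) auto
    moreover have "(\<Sum>z\<in>mu_set t (- x). hecke_scale (const (mu z (- x))) (KL (- z) \<star> KL y')) \<in> int_mult 1"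
    proof (intro int_mult_sum int_mult_const)
      \<comment> \<open>\<open>z\<close> starts with \<open>t\<close>, so \<open>- z\<close> ends in
        \<open>t\<close> and \<open>ends\<close> applies.\<close>
      fix z assume z: "z \<in> mu_set t (- x)"
      then show "KL (- z) \<star> KL y' \<in> int_mult 1" "mu z (- x) \<in> \<int>"
        using mu_setD[OF z] rdesc_iff[OF t, of "- z"] t by (auto intro!: ends[of t])
    qed
    ultimately show ?thesis unfolding up' using False
      by (simp add: d_def hecke_mult_sum int_mult_diff)
  qed
  have "KL x \<star> KL y = (KL x \<star> cs t) \<star> KL y' + KL x \<star> mu_sum t y'"
    unfolding y KL_up[OF t up] by (simp add: hecke_assoc)
  then show ?case using int_mult_add[OF main mu] by (simp add: d_def)
qed

lemma kl_h_eq: "kl_h S x y w = co w (KL x \<star> KL y)"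
  by (simp add: kl_h_def kl_C_eq co_def)

lemma KL_mult_cases: "KL x \<star> KL y \<in> int_mult 1 \<or> KL x \<star> KL y \<in> int_mult v_sum"
proof -
  consider "x = 0 \<or> y = 0" | "multi_red x \<or> multi_red y"
    | "x \<noteq> 0" "y \<noteq> 0" "\<not> multi_red x" "\<not> multi_red y" by blast
  then show ?thesis
  proof cases
    case 1
    then show ?thesis using KL_int_mult by auto
  next
    case 2
    then show ?thesis
      using int_mult_0_left int_mult_0_right KL_multi_red int_mult_0_subset by blast
  next
    case 3
    obtain t where "t \<in> S" "ldesc t y" using exists_ldesc 3 by blast
    moreover obtain s where "s \<in> S" "rdesc s x"
      using exists_ldesc[of "- x"] 3 rdesc_iff by auto
    ultimately show ?thesis using KL_mult_int_mult[of s t x y] 3 by (auto split: if_splits)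
  qed
qed

text \<open>The structure constants at \<open>w\<close> are \<open>n\<close> or
  \<open>n * v_sum\<close> with an integer \<open>n\<close>; one factor \<open>q^(1/2)\<close> turns
  them into \<open>n q^(1/2)\<close> and \<open>n (1 + q)\<close>.\<close>

lemma a_fun_le_1:
  assumes "\<not> multi_red w" shows "a_fun S w \<le> 1"
proof -
  have "qhalf 1 * kl_h S x y w \<in> range (\<lambda>p. int_poly_at p (qhalf 1))" for x y
  proof -
    have "(\<exists>n::int. kl_h S x y w = of_int n) \<or> (\<exists>n::int. kl_h S x y w = v_sum * of_int n)"
      using KL_mult_cases[of x y] assms unfolding kl_h_eq int_mult_def
      by (simp only: mem_Collect_eq mult_1_left) blast
    then consider n where "kl_h S x y w = of_int n" | n where "kl_h S x y w = v_sum * of_int n"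
      by blast
    then show ?thesis
    proof cases
      case 1
      then have "qhalf 1 * kl_h S x y w = int_poly_at [:0, n:] (qhalf 1)"
        by (simp add: int_poly_at_pCons)
      then show ?thesis by blast
    next
      case 2
      then have "qhalf 1 * kl_h S x y w = int_poly_at [:n, 0, n:] (qhalf 1)"
        by (simp add: int_poly_at_pCons ring_distribs qhalf_add flip: mult.assoc)
      then show ?thesis by blast
    qed
  qed
  then have "a_fun S w \<le> enat 1" unfolding a_fun_def by (intro INF_lower) simp
  then show ?thesis by (simp add: one_enat_def)
qed

section \<open>Dihedral parabolic subgroups\<close>

lemma qhalf_nonzero [simp]: "qhalf k \<noteq> 0"
  using lookup_qhalf[of k k] by auto

lemma KL_support_closed:
  assumes s: "s \<in> S" and w: "ldesc s w"
  shows "lookup (KL w) (s + y) \<noteq> 0 \<longleftrightarrow> lookup (KL w) y \<noteq> 0"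
proof (cases "ldesc s y")
  case True
  then have "\<not> ldesc s (s + y)" using ldesc_gen_self[OF s] by simp
  then show ?thesis using lookup_KL_down[OF s w, of "s + y"] s by simp
next
  case False
  then show ?thesis using lookup_KL_down[OF s w] by simp
qed

lemma two_ldesc_cox_m_finite:
  assumes r: "r \<in> S" "ldesc r w" and t: "t \<in> S" "ldesc t w"
  shows "cox_m r t < \<infinity>"
proof -
  have "npow k (r + t) + w \<in> keys (KL w)" for k
  proof (induction k)
    case (Suc k)
    have "npow (Suc k) (r + t) + w = r + (t + (npow k (r + t) + w))" by (simp add: add.assoc)
    then show ?case using Suc KL_support_closed[OF r] KL_support_closed[OF t]
      by (simp only: in_keys_iff) simp
  qed (simp add: in_keys_iff)
  then have "range (\<lambda>k. npow k (r + t) + w) \<subseteq> keys (KL w)" by blast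
  then have "\<not> inj (\<lambda>k::nat. npow k (r + t) + w)"
    using finite_subset[OF _ finite_keys] finite_imageD by (metis infinite_UNIV_nat)
  then obtain i j :: nat where "i \<noteq> j" "npow i (r + t) + w = npow j (r + t) + w"
    by (auto simp: inj_def)
  then obtain i j where ij: "i < j" "npow i (r + t) = npow j (r + t)"
    by (metis add_right_cancel linorder_neqE_nat)
  have "npow i (r + t) + npow (j - i) (r + t) = npow j (r + t)"
    using ij(1) by (simp flip: npow_add)
  also have "\<dots> = npow i (r + t) + 0" using ij(2) by simp
  finally have "npow (j - i) (r + t) = 0" by (simp only: add_left_cancel)
  with ij(1) show ?thesis unfolding cox_m_finite_iff by (intro exI[of _ "j - i"]) simp
qed

definition dihedral :: "'w \<Rightarrow> 'w \<Rightarrow> 'w set" where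
  "dihedral r t = sum_list ` lists {r, t}"

lemma dihedral_add:
  assumes "x \<in> dihedral r t" "y \<in> dihedral r t" shows "x + y \<in> dihedral r t"
proof -
  obtain u v where "u \<in> lists {r, t}" "sum_list u = x" "v \<in> lists {r, t}" "sum_list v = y"
    using assms unfolding dihedral_def by blast
  then have "u @ v \<in> lists {r, t}" "x + y = sum_list (u @ v)" by auto
  then show ?thesis unfolding dihedral_def by (rule rev_image_eqI)
qed

lemma dihedral_gen: "r \<in> dihedral r t" "t \<in> dihedral r t" "0 \<in> dihedral r t"
  unfolding dihedral_def
  by (auto intro: image_eqI[of _ _ "[r]"] image_eqI[of _ _ "[t]"] image_eqI[of _ _ "[]"])

context
  fixes r t
  assumes r: "r \<in> S" and t: "t \<in> S"
begin

lemma dihedral_lists: "u \<in> lists {r, t} \<Longrightarrow> u \<in> lists S"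
  using r t by auto

text \<open>\<open>exchange\<close> only deletes letters, so shortening a word in \<open>r\<close>
  and \<open>t\<close> to a reduced one never leaves these letters.\<close>

lemma dihedral_red:
  assumes "y \<in> dihedral r t"
  shows "\<exists>u. u \<in> lists {r, t} \<and> red u \<and> sum_list u = y"
proof -
  obtain u where "u \<in> lists {r, t}" "sum_list u = y" using assms by (auto simp: dihedral_def)
  moreover have "u \<in> lists {r, t} \<Longrightarrow> \<exists>v. v \<in> lists {r, t} \<and> red v \<and> sum_list v = sum_list u" for u
  proof (induction u)
    case Nil
    then show ?case by (intro exI[of _ "[]"]) (simp add: red_def)
  next
    case (Cons a u)
    then have a: "a \<in> {r, t}" "a \<in> S" using r t by auto
    obtain v where v: "v \<in> lists {r, t}" "red v" "sum_list v = sum_list u" using Cons by auto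
    show ?case
    proof (cases "ldesc a (sum_list v)")
      case True
      then have "inv_set (sum_list v) a" using ldesc_iff a by blast
      then obtain v' where v': "set v' \<subseteq> set v" "Suc (length v') = length v"
          "a + sum_list v = sum_list v'"
        using exchange[OF dihedral_lists[OF v(1)]] by blast
      then have "v' \<in> lists {r, t}" using v(1) by auto
      moreover from this have "red v'"
        using dihedral_lists v' v(2) ldesc_len[OF a(2) True] by (auto simp: red_def)
      ultimately show ?thesis using v v' by auto
    next
      case False
      have "a # v \<in> lists {r, t}" using a v by simp
      then show ?thesis using red_Cons[OF a(2) v(2) False] v(3) by (intro exI[of _ "a # v"]) simp
    qed
  qed
  ultimately show ?thesis by blast
qed

lemma dihedral_uminus: assumes "y \<in> dihedral r t" shows "- y \<in> dihedral r t"
proof -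
  obtain u where "u \<in> lists {r, t}" "red u" "sum_list u = y" using dihedral_red[OF assms] by blast
  then have "rev u \<in> lists {r, t}" "sum_list (rev u) = - y" using red_rev by auto
  then show ?thesis unfolding dihedral_def by (metis imageI)
qed

text \<open>By strong exchange, each Bruhat step down is the deletion of a letter from a word in
  \<open>r\<close> and \<open>t\<close>.\<close>

lemma dihedral_bruhat:
  assumes "bruhat_le S x y" "y \<in> dihedral r t" shows "x \<in> dihedral r t"
  using assms unfolding bruhat_le_def
proof (induction rule: converse_rtranclp_induct)
  case (step x y)
  then obtain p where p: "p \<in> reflections S" "y = p + x" "len x < len y" by blast
  then have px: "p + y = x" using reflection_double[OF p(1)] by (simp flip: add.assoc)
  then have "inv_set y p" using len_refl_iff(1)[OF p(1), of y] p by simp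
  moreover obtain u where u: "u \<in> lists {r, t}" "sum_list u = y"
    using step by (auto simp: dihedral_def)
  ultimately obtain v where "set v \<subseteq> set u" "p + y = sum_list v"
    using exchange[OF dihedral_lists[OF u(1)], of p] by blast
  moreover from this have "v \<in> lists {r, t}" using u by auto
  ultimately show ?case using px by (auto simp: dihedral_def)
qed

lemma dihedral_pow:
  "r + npow k (r + t) = - npow k (r + t) + r" "t + npow k (r + t) = - npow k (r + t) + t"
proof (induction k)
  case (Suc k)
  have m: "- npow (Suc k) (r + t) = - npow k (r + t) + (t + r)"
    using r t by (simp add: minus_add del: add_uminus_conv_diff)
  {
    case 1
    have "r + npow (Suc k) (r + t) = (r + npow k (r + t)) + (r + t)"
      unfolding npow_Suc_right by (simp add: add.assoc)
    also have "\<dots> = - npow k (r + t) + (t + r) + r" unfolding Suc using r by (simp add: add.assoc)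
    finally show ?case unfolding m .
  next
    case 2
    have "t + npow (Suc k) (r + t) = (t + npow k (r + t)) + (r + t)"
      unfolding npow_Suc_right by (simp add: add.assoc)
    also have "\<dots> = - npow k (r + t) + (t + r) + t" unfolding Suc by (simp add: add.assoc)
    finally show ?case unfolding m .
  }
qed simp_all

lemma finite_dihedral:
  assumes "cox_m r t < \<infinity>" shows "finite (dihedral r t)"
proof -
  obtain n where n: "n > 0" "npow n (r + t) = 0" using assms unfolding cox_m_finite_iff by blast
  define P where "P = range (\<lambda>k. npow k (r + t))"
  have period: "npow (n * k) (r + t) = 0" for k
    by (induction k) (simp_all add: npow_add n)
  have mod: "npow k (r + t) = npow (k mod n) (r + t)" for k
    using npow_add[of "n * (k div n)" "k mod n" "r + t"] period by simp
  have "P \<subseteq> (\<lambda>k. npow k (r + t)) ` {..<n}"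
  proof
    fix x assume "x \<in> P"
    then obtain k where "x = npow k (r + t)" by (auto simp: P_def)
    then have "x = npow (k mod n) (r + t)" using mod[of k] by simp
    then show "x \<in> (\<lambda>k. npow k (r + t)) ` {..<n}" by (rule image_eqI) (use n(1) in simp)
  qed
  then have "finite P" by (rule finite_subset) simp
  have minus: "- npow k (r + t) \<in> P" for k
  proof -
    have "npow (n * k - k) (r + t) + npow k (r + t) = 0"
      using period[of k] n(1) by (simp flip: npow_add)
    then have "- npow k (r + t) = npow (n * k - k) (r + t)" by (metis minus_unique minus_minus)
    then show ?thesis by (auto simp: P_def)
  qed
  \<comment> \<open>The rotations \<open>P\<close>, a cyclic group generated by
    \<open>r + t\<close>, together with the reflections, its coset by \<open>r\<close>.\<close>
  let ?A = "P \<union> (\<lambda>x. x + r) ` P"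
  have t_mult: "t + npow k (r + t) = - npow (Suc k) (r + t) + r" for k
    unfolding dihedral_pow(2) using r t by (simp add: minus_add add.assoc del: add_uminus_conv_diff)
  have closed: "r + x \<in> ?A \<and> t + x \<in> ?A" if "x \<in> ?A" for x
  proof -
    from that consider k where "x = npow k (r + t)" | k where "x = npow k (r + t) + r"
      by (auto simp: P_def)
    then show ?thesis
    proof cases
      case 1
      then show ?thesis unfolding 1 dihedral_pow(1) t_mult using minus by blast
    next
      case 2
      have e: "r + x = - npow k (r + t)" "t + x = - npow (Suc k) (r + t)"
        unfolding 2 add.assoc[symmetric] dihedral_pow(1) t_mult using r by simp_all
      show ?thesis unfolding e using minus by blast
    qed
  qed
  have "sum_list u \<in> ?A" if "u \<in> lists {r, t}" for u
    using that
  proof induction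
    case Nil
    have "npow 0 (r + t) \<in> P" unfolding P_def by blast
    then show ?case by simp
  next
    case (Cons a u)
    then show ?case using closed[OF Cons.IH] by auto
  qed
  then have "dihedral r t \<subseteq> ?A" by (auto simp: dihedral_def)
  then show ?thesis by (rule finite_subset) (use \<open>finite P\<close> in simp)
qed

text \<open>The support lies in the subgroup, contains \<open>w\<close> and is stable under left
  multiplication by \<open>r\<close> and \<open>t\<close>, which act transitively. In
  \<open>KL_dihedral_coeff\<close> this shows that only the longest element has both
  descents.\<close>

lemma KL_support_dihedral:
  assumes "w \<in> dihedral r t" "ldesc r w" "ldesc t w"
  shows "keys (KL w) = dihedral r t"
proof
  show "keys (KL w) \<subseteq> dihedral r t"
    using dihedral_bruhat[OF _ assms(1)] KL_bruhat by (auto simp: in_keys_iff)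
  have "sum_list u + w \<in> keys (KL w)" if "u \<in> lists {r, t}" for u
    using that
  proof induction
    case (Cons a u)
    then show ?case using KL_support_closed[OF r assms(2)] KL_support_closed[OF t assms(3)]
      by (auto simp: in_keys_iff add.assoc)
  qed (simp add: in_keys_iff)
  then have *: "x + w \<in> keys (KL w)" if "x \<in> dihedral r t" for x
    using that by (auto simp: dihedral_def)
  show "dihedral r t \<subseteq> keys (KL w)"
  proof
    fix y assume "y \<in> dihedral r t"
    then have "y + - w + w \<in> keys (KL w)"
      by (intro * dihedral_add dihedral_uminus assms(1))
    then show "y \<in> keys (KL w)" by simp
  qed
qed

lemma T_mult_KL_dihedral:
  assumes "ldesc r w" "ldesc t w" "y \<in> dihedral r t"
  shows "T y \<star> KL w = hecke_scale ((- 1) ^ len y * qhalf (- int (len y))) (KL w)"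
proof -
  obtain u where u: "u \<in> lists {r, t}" "red u" "sum_list u = y" using dihedral_red[OF assms(3)] by blast
  have "u \<in> lists {r, t} \<Longrightarrow> red u \<Longrightarrow>
    T (sum_list u) \<star> KL w = hecke_scale ((- 1) ^ length u * qhalf (- int (length u))) (KL w)" for u
  proof (induction u)
    case (Cons a u)
    then have a: "a \<in> S" "ldesc a w" using r t assms by auto
    have IH: "T (sum_list u) \<star> KL w = hecke_scale ((- 1) ^ length u * qhalf (- int (length u))) (KL w)"
      using Cons red_ConsD[OF Cons.prems(2)] by simp
    have "T (sum_list (a # u)) \<star> KL w = T a \<star> (T (sum_list u) \<star> KL w)"
      using red_ConsD[OF Cons.prems(2)] by (simp add: T_add hecke_assoc)
    also have "\<dots> = hecke_scale ((- 1) ^ length u * qhalf (- int (length u)) * - qhalf (- 1)) (KL w)"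
      unfolding IH using T_KL_down[OF a] by simp
    also have "(- 1) ^ length u * qhalf (- int (length u)) * - qhalf (- 1) =
        (- 1) ^ length (a # u) * qhalf (- int (length (a # u)))"
      by (simp add: mult.assoc qhalf_add algebra_simps)
    finally show ?case .
  qed simp
  from this[OF u(1,2)] show ?thesis using u by (simp add: red_def)
qed

section \<open>The longest element of a finite dihedral subgroup\<close>

context
  assumes distinct: "r \<noteq> t" and finite: "cox_m r t < \<infinity>"
begin

lemma exists_dihedral_longest:
  "\<exists>w \<in> dihedral r t. (\<forall>y \<in> dihedral r t. len y \<le> len w) \<and> ldesc r w \<and> ldesc t w"
proof -
  have "dihedral r t \<noteq> {}" using dihedral_gen by blast
  then obtain w where w: "w \<in> dihedral r t" "\<forall>y \<in> dihedral r t. len y \<le> len w"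
    using exists_longest[OF finite_dihedral[OF finite]] by blast
  have "ldesc a w" if "a \<in> S" "a \<in> dihedral r t" for a
    using w dihedral_add[OF that(2) w(1)] not_ldesc_len[OF that(1), of w] by fastforce
  then show ?thesis using w r t dihedral_gen by blast
qed

context
  fixes w
  assumes w: "w \<in> dihedral r t" "ldesc r w" "ldesc t w"
    and longest: "\<forall>y \<in> dihedral r t. len y \<le> len w"
begin

text \<open>Starting from 1 at the longest element, each step down contributes a factor
  \<open>- qhalf 1\<close> by \<open>lookup_KL_down\<close>. In other words, all polynomials
  \<open>P\<close> are 1 here.\<close>

lemma KL_dihedral_coeff:
  assumes "y \<in> dihedral r t"
  shows "lookup (KL w) y = (- 1) ^ (len w + len y) * qhalf (int (len w) - int (len y))"
  using assms
proof (induction "len w - len y" arbitrary: y rule: less_induct)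
  case less
  show ?case
  proof (cases "y = w")
    case True
    then show ?thesis by (simp flip: mult_2)
  next
    case False
    \<comment> \<open>With both descents, \<open>KL y\<close> would have full support, and its
      support contains nothing else as long as \<open>y\<close>.\<close>
    have "\<not> (ldesc r y \<and> ldesc t y)"
    proof
      assume "ldesc r y \<and> ldesc t y"
      then have "w \<in> keys (KL y)" using KL_support_dihedral less.prems w by blast
      then show False using KL_len[of y w] bspec[OF longest less.prems] False by (auto simp: in_keys_iff)
    qed
    then obtain a where a: "a \<in> S" "a \<in> dihedral r t" "ldesc a w" "\<not> ldesc a y"
      using r t w dihedral_gen by blast
    have ay: "a + y \<in> dihedral r t" by (rule dihedral_add[OF a(2) less.prems])
    have l: "len (a + y) = Suc (len y)" by (rule not_ldesc_len[OF a(1,4)])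
    have "lookup (KL w) y = - (qhalf 1 * lookup (KL w) (a + y))"
      unfolding lookup_KL_down[OF a(1,3,4)] by (simp add: qhalf_add flip: mult.assoc)
    also have "lookup (KL w) (a + y) = (- 1) ^ (len w + len (a + y)) * qhalf (int (len w) - int (len (a + y)))"
      by (rule less.hyps[OF _ ay]) (use l bspec[OF longest ay] in simp)
    also have "- (qhalf 1 * \<dots>) = (- 1) ^ (len w + len y) * qhalf (int (len w) - int (len y))"
      by (simp add: l qhalf_add mult.left_commute)
    finally show ?thesis .
  qed
qed

lemma a_fun_dihedral: "1 < a_fun S w"
proof (rule ccontr)
  assume "\<not> 1 < a_fun S w"
  then have "a_fun S w \<le> 1" by (simp only: not_less)
  also have "1 < enat 2" by (simp add: one_enat_def)
  finally obtain i where "enat i < enat 2"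
    and "\<forall>x y. qhalf (int i) * kl_h S x y w \<in> range (\<lambda>p. int_poly_at p (qhalf 1))"
    unfolding a_fun_def INF_less_iff by blast
  then have i: "i < 2" and "qhalf (int i) * kl_h S w w w \<in> range (\<lambda>p. int_poly_at p (qhalf 1))"
    by (simp, blast)
  then obtain p where p: "qhalf (int i) * kl_h S w w w = int_poly_at p (qhalf 1)" by blast
  let ?D = "dihedral r t"
  have "KL w = (\<Sum>y\<in>?D. hecke_scale (lookup (KL w) y) (T y))"
    using hecke_expand[of "KL w"] KL_support_dihedral[OF w] by simp
  then have "KL w \<star> KL w = (\<Sum>y\<in>?D. hecke_scale (lookup (KL w) y) (T y)) \<star> KL w"
    by (rule arg_cong)
  also have "\<dots> = (\<Sum>y\<in>?D. hecke_scale ((- 1) ^ len w * qhalf (int (len w) - 2 * int (len y))) (KL w))"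
    unfolding hecke_mult_sum
  proof (rule sum.cong)
    fix y assume y: "y \<in> ?D"
    have "lookup (KL w) y * ((- 1) ^ len y * qhalf (- int (len y))) =
        (- 1) ^ (len w + len y + len y) * (qhalf (int (len w) - int (len y)) * qhalf (- int (len y)))"
      unfolding KL_dihedral_coeff[OF y] power_add by (simp only: ac_simps)
    also have "\<dots> = (- 1) ^ len w * qhalf (int (len w) - 2 * int (len y))"
      by (simp add: qhalf_add power_add algebra_simps flip: power_mult_distrib)
    finally show "hecke_scale (lookup (KL w) y) (T y) \<star> KL w =
        hecke_scale ((- 1) ^ len w * qhalf (int (len w) - 2 * int (len y))) (KL w)"
      using T_mult_KL_dihedral[OF w(2,3) y] by simp
  qed simp
  finally have "kl_h S w w w = (\<Sum>y\<in>?D. (- 1) ^ len w * qhalf (int (len w) - 2 * int (len y)))"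
    unfolding kl_h_eq by (simp add: additive.sum[OF co_additive] co_KL)
  \<comment> \<open>The lowest exponent \<open>- len w\<close> comes only from elements of maximal
    length, all with the same sign, so nothing cancels.\<close>
  then have "lookup (kl_h S w w w) (- int (len w)) =
      (\<Sum>y\<in>?D. if len y = len w then (- 1) ^ len w else 0)"
    by (simp add: lookup_sum lookup_sign_mult lookup_qhalf) (intro sum.cong, auto)
  also have "\<dots> = (- 1) ^ len w * of_nat (card {y \<in> ?D. len y = len w})"
    using finite_dihedral[OF finite] by (simp add: sum.If_cases Int_def)
  finally have H: "lookup (kl_h S w w w) (- int (len w)) \<noteq> 0"
    using finite_dihedral[OF finite] w by auto
  \<comment> \<open>\<open>r + t\<close> is nontrivial of even length, so \<open>len w\<close> is at
    least 2 and a factor \<open>q^(i/2)\<close> with \<open>i < 2\<close> leaves a negative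
    exponent.\<close>
  have "r + t \<noteq> 0" using distinct r t by (metis add_eq_0_iff gen_minus)
  moreover have "even (len (r + t))" using len_parity[of "[r, t]"] r t by simp
  ultimately have "2 \<le> len (r + t)"
    by (metis One_nat_def Suc_1 len_eq_0_iff less_2_cases not_less odd_one)
  also have "\<dots> \<le> len w" by (intro bspec[OF longest] dihedral_add dihedral_gen)
  finally have "lookup (int_poly_at p (qhalf 1)) (int i - int (len w)) = 0"
    using i by (simp add: lookup_int_poly_at)
  then show False using H by (simp flip: p)
qed

end

end

end

end

section \<open>Representations\<close>

locale coxeter_rep = coxeter S for S :: "'w::group_add set" +
  fixes scale :: "complex \<Rightarrow> 'v::ab_group_add \<Rightarrow> 'v" and \<rho> :: "'w \<Rightarrow> 'v \<Rightarrow> 'v"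
  assumes rep: "complex_representation scale \<rho>"
begin

sublocale vs: vector_space scale
  using rep by (simp add: complex_representation_def)

lemma rho_linear: "Vector_Spaces.linear scale scale (\<rho> g)"
  using rep by (simp add: complex_representation_def)

lemmas rho_hom = Vector_Spaces.linear.axioms(3)[OF rho_linear]

lemmas rho_simps [simp] = module_hom.add[OF rho_hom] module_hom.scale[OF rho_hom]
  module_hom.zero[OF rho_hom] module_hom.neg[OF rho_hom]

lemma rho_0 [simp]: "\<rho> 0 x = x"
  using rep by (simp add: complex_representation_def)

lemma rho_add: "\<rho> (g + h) x = \<rho> g (\<rho> h x)"
  using rep by (simp add: complex_representation_def)

definition act :: "'w hecke \<Rightarrow> 'v \<Rightarrow> 'v" where
  "act h v = group_algebra_action scale \<rho> (hecke_at_one h) v"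

lemma lookup_hecke_at_one: "lookup (hecke_at_one h) g = laurent_at_one (lookup h g)"
  by (simp add: hecke_at_one_def Poly_Mapping.map.rep_eq when_def)

lemma act_superset:
  assumes "finite A" "keys h \<subseteq> A"
  shows "act h v = (\<Sum>g\<in>A. scale (laurent_at_one (lookup h g)) (\<rho> g v))"
proof -
  have "keys (hecke_at_one h) \<subseteq> keys h" by (auto simp: in_keys_iff lookup_hecke_at_one)
  then have "keys (hecke_at_one h) \<subseteq> A" using assms(2) by blast
  then show ?thesis
    unfolding act_def group_algebra_action_def lookup_hecke_at_one
    by (rule sum.mono_neutral_left[OF assms(1)]) (auto simp: in_keys_iff lookup_hecke_at_one)
qed

lemma act_add [simp]: "act (h + h') v = act h v + act h' v"
proof -
  let ?A = "keys h \<union> keys h'"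
  have "keys (h + h') \<subseteq> ?A" by (rule keys_add)
  then show ?thesis
    by (simp add: act_superset[of ?A] lookup_add vs.scale_left_distrib sum.distrib)
qed

lemma act_scale [simp]: "act (hecke_scale c h) v = scale (laurent_at_one c) (act h v)"
  using keys_hecke_scale[of c h]
  by (simp add: act_superset[of "keys h"] lookup_hecke_scale vs.scale_sum_right)

lemma act_T [simp]: "act (T w) v = \<rho> w v"
  by (simp add: act_superset[of "{w}"] lookup_T hecke_T_def)

lemma act_additive: "additive (\<lambda>h. act h v)"
  by (simp add: additive_def)

lemmas act_diff [simp] = additive.diff[OF act_additive]
lemmas act_uminus [simp] = additive.minus[OF act_additive]
lemmas act_zero [simp] = additive.zero[OF act_additive]
lemmas act_sum = additive.sum[OF act_additive]

text \<open>At \<open>q^(1/2) = 1\<close> the term with \<open>xi\<close> vanishes, so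
  \<open>T s\<close> acts as \<open>s\<close>.\<close>

lemma act_T_mult: assumes "s \<in> S" shows "act (T s \<star> h) v = \<rho> s (act h v)"
proof (rule hecke_additive_eqI[where f = "\<lambda>h. act (T s \<star> h) v" and g = "\<lambda>h. \<rho> s (act h v)"])
  show "act (T s \<star> hecke_scale c (T w)) v = \<rho> s (act (hecke_scale c (T w)) v)" for c w
    using assms by (simp add: T_mult_left lmul_T rho_add xi_def)
qed simp_all

lemma act_cs_mult: "s \<in> S \<Longrightarrow> act (cs s \<star> h) v = \<rho> s (act h v) - act h v"
  by (simp add: cs_def act_T_mult)

lemma rho_act_KL: "s \<in> S \<Longrightarrow> ldesc s w \<Longrightarrow> \<rho> s (act (KL w) v) = - act (KL w) v"
  using act_T_mult[of s "KL w" v] T_KL_down[of s w] by simp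

lemma act_KL_multi_red:
  assumes no_vector: "\<And>v r t. r \<in> S \<Longrightarrow> t \<in> S \<Longrightarrow> r \<noteq> t \<Longrightarrow> cox_m r t < \<infinity> \<Longrightarrow>
      \<rho> r v = - v \<Longrightarrow> \<rho> t v = - v \<Longrightarrow> v = 0"
    and "multi_red w"
  shows "act (KL w) v = 0"
  using assms(2)
proof (induction "len w" arbitrary: w rule: less_induct)
  case less
  obtain s where s: "s \<in> S" "ldesc s w" using exists_ldesc[OF multi_red_nonzero[OF less.prems]] by blast
  show ?case
  proof (cases "\<exists>t\<in>S. t \<noteq> s \<and> ldesc t w")
    case True
    then obtain t where t: "t \<in> S" "t \<noteq> s" "ldesc t w" by blast
    show ?thesis
      using no_vector[OF s(1) t(1) _ two_ldesc_cox_m_finite[OF s t(1,3)] rho_act_KL[OF s] rho_act_KL[OF t(1,3)]]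
        t(2) by auto
  next
    case False
    define w' where "w' = s + w"
    have w: "w = s + w'" and up: "\<not> ldesc s w'" and l: "len w' < len w"
      using s by (auto simp: w'_def)
    have w': "multi_red w'" unfolding w'_def by (rule multi_red_down[OF less.prems]) (use False in auto)
    have "act (mu_sum s w') v = 0"
      unfolding mu_sum_def act_sum
    proof (rule sum.neutral, rule ballI)
      fix z assume z: "z \<in> mu_set s w'"
      then have "act (KL z) v = 0"
        using less.hyps[of z] mu_setD(3)[OF z] l mu_multi_red[OF s(1) up w' z] by simp
      then show "act (hecke_scale (const (mu z w')) (KL z)) v = 0" by simp
    qed
    \<comment> \<open>\<open>cs s\<close> acts as \<open>s - 1\<close>, here on a vector that is
      zero by induction.\<close>
    moreover have "act (cs s \<star> KL w') v = 0"
      using less.hyps[OF l w'] s by (simp add: act_cs_mult)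
    ultimately show ?thesis unfolding w KL_up[OF s(1) up] by simp
  qed
qed

text \<open>At \<open>q^(1/2) = 1\<close> the coefficient of \<open>y\<close> is
  \<open>(- 1) ^ (len w + len y)\<close>, and \<open>y\<close> acts on \<open>v\<close> by
  \<open>(- 1) ^ len y\<close>. All terms therefore agree, and their number is nonzero in
  \<open>\<complex>\<close>.\<close>

lemma act_KL_dihedral:
  assumes r: "r \<in> S" "\<rho> r v = - v" and t: "t \<in> S" "\<rho> t v = - v" and rt: "r \<noteq> t" "cox_m r t < \<infinity>"
    and w: "w \<in> dihedral r t" "ldesc r w" "ldesc t w" "\<forall>y \<in> dihedral r t. len y \<le> len w"
    and v: "v \<noteq> 0"
  shows "act (KL w) v \<noteq> 0"
proof -
  have rho: "\<rho> y v = scale ((- 1) ^ len y) v" if "y \<in> dihedral r t" for y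
  proof -
    obtain u where u: "u \<in> lists {r, t}" "red u" "sum_list u = y"
      using dihedral_red[OF r(1) t(1) \<open>y \<in> dihedral r t\<close>] by blast
    have "\<rho> (sum_list u) v = scale ((- 1) ^ length u) v"
      using u(1) by induction (auto simp: rho_add r t)
    then show ?thesis using u by (simp add: red_def)
  qed
  have sign: "laurent_at_one ((- 1) ^ n * c) = (- 1) ^ n * laurent_at_one c" for n c
    by (cases "even n") simp_all
  have "act (KL w) v = (\<Sum>y\<in>dihedral r t. scale ((- 1) ^ len w) v)"
    unfolding act_superset[OF finite_keys order_refl] KL_support_dihedral[OF r(1) t(1) w(1-3)]
  proof (rule sum.cong)
    fix y assume y: "y \<in> dihedral r t"
    show "scale (laurent_at_one (lookup (KL w) y)) (\<rho> y v) = scale ((- 1) ^ len w) v"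
      unfolding KL_dihedral_coeff[OF r(1) t(1) rt w y] rho[OF y] sign vs.scale_scale
      by (simp add: power_add mult.assoc flip: power_mult_distrib)
  qed simp
  also have "\<dots> = scale (of_nat (card (dihedral r t)) * (- 1) ^ len w) v"
    by (simp add: vs.sum_constant_scale)
  finally show ?thesis
    using v w(1) finite_dihedral[OF r(1) t(1) rt(2)] by (auto simp: vs.scale_eq_0_iff)
qed

end

theorem theorem3p12:
  fixes S :: "'w::group_add set"
    and scale :: "complex \<Rightarrow> 'v::ab_group_add \<Rightarrow> 'v"
    and \<rho> :: "'w \<Rightarrow> 'v \<Rightarrow> 'v"
  assumes "coxeter_system S" and "finite S"
    and "complex_representation scale \<rho>"
  shows "(\<forall>w. a_fun S w > 1 \<longrightarrow>
            (\<forall>v. group_algebra_action scale \<rho> (hecke_at_one (kl_C S w)) v = 0)) \<longleftrightarrow>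
         \<not> (\<exists>v. v \<noteq> 0 \<and>
              (\<exists>r \<in> S. \<exists>t \<in> S. r \<noteq> t \<and> cox_m r t < \<infinity> \<and> \<rho> r v = - v \<and> \<rho> t v = - v))"
proof -
  interpret coxeter_rep S scale \<rho>
    by unfold_locales (fact assms)+
  show ?thesis unfolding kl_C_eq act_def[symmetric]
  proof (intro iffI allI impI notI)
    assume zero: "\<forall>w. a_fun S w > 1 \<longrightarrow> (\<forall>v. act (KL w) v = 0)"
    assume "\<exists>v. v \<noteq> 0 \<and>
      (\<exists>r \<in> S. \<exists>t \<in> S. r \<noteq> t \<and> cox_m r t < \<infinity> \<and> \<rho> r v = - v \<and> \<rho> t v = - v)"
    then obtain v r t where v: "v \<noteq> 0" and r: "r \<in> S" "\<rho> r v = - v" and t: "t \<in> S" "\<rho> t v = - v"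
      and rt: "r \<noteq> t" "cox_m r t < \<infinity>" by blast
    obtain w where w: "w \<in> dihedral r t" "ldesc r w" "ldesc t w"
      and longest: "\<forall>y \<in> dihedral r t. len y \<le> len w"
      using exists_dihedral_longest[OF r(1) t(1) rt] by blast
    have "1 < a_fun S w" by (rule a_fun_dihedral[OF r(1) t(1) rt w longest])
    then show False using zero act_KL_dihedral[OF r t rt w longest v] by blast
  next
    fix w v
    assume none: "\<not> (\<exists>v. v \<noteq> 0 \<and>
      (\<exists>r \<in> S. \<exists>t \<in> S. r \<noteq> t \<and> cox_m r t < \<infinity> \<and> \<rho> r v = - v \<and> \<rho> t v = - v))"
    assume "1 < a_fun S w"
    then have "multi_red w" using a_fun_le_1 not_le by blast
    then show "act (KL w) v = 0" by (rule act_KL_multi_red[rotated]) (use none in blast)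
  qed
qed

end
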